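(* Let $\alpha\in(0,1]$ and $A\in C(\mathbb{R},\mathbb{R}^{n\times n})$. Let $X(t)$ be the fundamental matrix of $\mathcal{T}^\alpha x=A(t)x$ with $X(0)=I$, and suppose this equation possesses a Mittag-Leffler dichotomy in $\mathbb{R}_+$, i.e. there are a projection matrix $P$ ($P^2=P$) and constants $N_1,N_2,\beta_1,\beta_2>0$ with $$\|X(t)PX^{-1}(s)\|\le N_1\frac{E_\alpha(\beta_1,s)}{E_\alpha(\beta_1,t)},\ t\ge s\ge0,\qquad \|X(t)(I-P)X^{-1}(s)\|\le N_2\frac{E_\alpha(\beta_2,t)}{E_\alpha(\beta_2,s)},\ s\ge t\ge0.$$ Then there exists $\varepsilon_0>0$ such that for every bounded continuous $B:\mathbb{R}\to\mathbb{R}^{n\times n}$ with $\varepsilon:=\sup_{t\ge0}\|B(t)\|<\varepsilon_0$, the perturbed equation $$\mathcal{T}^\alpha y=[A(t)+B(t)]y$$ also possesses a Mittag-Leffler dichotomy in $\mathbb{R}_+$.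
   Context: $\mathbb{R}_+=[0,\infty)$; $\|x\|=\sum_i|x_i|$ on $\mathbb{R}^n$ and $\|A\|$ is the maximal absolute column sum of a matrix. For $\alpha\in(0,1]$, $\mathcal{T}^\alpha g(t):=\lim_{\varepsilon\to0}\frac{g(t+\varepsilon|t|^{1-\alpha})-g(t)}{\varepsilon}$ (so $\mathcal{T}^\alpha g(t)=|t|^{1-\alpha}g'(t)$ for $t\ne0$), with $\mathcal{T}^\alpha g(0):=\lim_{t\to0}\mathcal{T}^\alpha g(t)$ if this limit exists; solutions are continuous functions satisfying the equation. A fundamental matrix of a linear equation is an $n\times n$ matrix function whose columns are $n$ linearly independent solutions. $E_\alpha(\lambda,t):=\exp(\lambda t^\alpha/\alpha)$ for $t\ge0$. A linear equation possesses a Mittag-Leffler dichotomy in $\mathbb{R}_+$ if there exist a fundamental matrix $Y(t)$, a matrix $Q$ with $Q^2=Q$ and positive constants $C_1,C_2,\mu_1,\mu_2$ such that $\|Y(t)QY^{-1}(s)\|\le C_1\frac{E_\alpha(\mu_1,s)}{E_\alpha(\mu_1,t)}$ for $t\ge s\ge0$ and $\|Y(t)(I-Q)Y^{-1}(s)\|\le C_2\frac{E_\alpha(\mu_2,t)}{E_\alpha(\mu_2,s)}$ for $s\ge t\ge0$. *)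

theory Defs
  imports "HOL-Analysis.Analysis"
begin

text \<open>
  The operator \<open>\<T>\<^sup>\<alpha>\<close> is rendered as a relation: \<open>has_conf_deriv \<alpha> g D t\<close> says that
  \<open>\<T>\<^sup>\<alpha> g(t)\<close> exists and equals \<open>D\<close>.  At \<open>t = 0\<close> the difference quotient is not used;
  there the value is the limit of \<open>\<T>\<^sup>\<alpha> g(t)\<close> as \<open>t\<close> tends to 0, which presupposes that
  \<open>\<T>\<^sup>\<alpha> g\<close> exists in a punctured neighbourhood of 0.
\<close>

definition has_conf_deriv_nz ::
    "real \<Rightarrow> (real \<Rightarrow> 'a::real_normed_vector) \<Rightarrow> 'a \<Rightarrow> real \<Rightarrow> bool" where
  "has_conf_deriv_nz \<alpha> g D t \<longleftrightarrow>
     ((\<lambda>e. (g (t + e * \<bar>t\<bar> powr (1 - \<alpha>)) - g t) /\<^sub>R e) \<longlongrightarrow> D) (at 0)"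

definition has_conf_deriv ::
    "real \<Rightarrow> (real \<Rightarrow> 'a::real_normed_vector) \<Rightarrow> 'a \<Rightarrow> real \<Rightarrow> bool" where
  "has_conf_deriv \<alpha> g D t \<longleftrightarrow>
     (if t \<noteq> 0 then has_conf_deriv_nz \<alpha> g D t
      else \<exists>h. (\<forall>\<^sub>F s in at 0. has_conf_deriv_nz \<alpha> g (h s) s) \<and> (h \<longlongrightarrow> D) (at 0))"

definition conf_solution ::
    "real \<Rightarrow> (real \<Rightarrow> real^'n^'n) \<Rightarrow> (real \<Rightarrow> real^'n) \<Rightarrow> bool" where
  "conf_solution \<alpha> A x \<longleftrightarrow>
     continuous_on UNIV x \<and> (\<forall>t. has_conf_deriv \<alpha> x (A t *v x t) t)"

text \<open>Linear independence below is that of the columns as functions on the real line.\<close>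

definition fundamental_matrix ::
    "real \<Rightarrow> (real \<Rightarrow> real^'n^'n) \<Rightarrow> (real \<Rightarrow> real^'n^'n) \<Rightarrow> bool" where
  "fundamental_matrix \<alpha> A Y \<longleftrightarrow>
     (\<forall>j. conf_solution \<alpha> A (\<lambda>t. column j (Y t))) \<and>
     (\<forall>c :: 'n \<Rightarrow> real. (\<forall>t. (\<Sum>j\<in>UNIV. c j *\<^sub>R column j (Y t)) = 0) \<longrightarrow> (\<forall>j. c j = 0))"

text \<open>The matrix norm induced by the 1-norm on vectors; it is not the library's \<^const>\<open>norm\<close>.\<close>

definition colsum_norm :: "real^'n^'m \<Rightarrow> real" where
  "colsum_norm M = Max (range (\<lambda>j. \<Sum>i\<in>UNIV. \<bar>M $ i $ j\<bar>))"

definition E_conf :: "real \<Rightarrow> real \<Rightarrow> real \<Rightarrow> real" where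
  "E_conf \<alpha> l t = exp (l * (t powr \<alpha>) / \<alpha>)"

definition mittag_leffler_estimates ::
    "real \<Rightarrow> (real \<Rightarrow> real^'n^'n) \<Rightarrow> real^'n^'n \<Rightarrow> real \<Rightarrow> real \<Rightarrow> real \<Rightarrow> real \<Rightarrow> bool" where
  "mittag_leffler_estimates \<alpha> Y Q C1 C2 \<mu>1 \<mu>2 \<longleftrightarrow>
     (\<forall>s t. 0 \<le> s \<and> s \<le> t \<longrightarrow>
        colsum_norm (Y t ** Q ** matrix_inv (Y s)) \<le> C1 * (E_conf \<alpha> \<mu>1 s / E_conf \<alpha> \<mu>1 t)) \<and>
     (\<forall>s t. 0 \<le> t \<and> t \<le> s \<longrightarrow>
        colsum_norm (Y t ** (mat 1 - Q) ** matrix_inv (Y s)) \<le> C2 * (E_conf \<alpha> \<mu>2 t / E_conf \<alpha> \<mu>2 s))"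

definition mittag_leffler_dichotomy :: "real \<Rightarrow> (real \<Rightarrow> real^'n^'n) \<Rightarrow> bool" where
  "mittag_leffler_dichotomy \<alpha> A \<longleftrightarrow>
     (\<exists>Y Q C1 C2 \<mu>1 \<mu>2. fundamental_matrix \<alpha> A Y \<and> Q ** Q = Q \<and>
        C1 > 0 \<and> C2 > 0 \<and> \<mu>1 > 0 \<and> \<mu>2 > 0 \<and> mittag_leffler_estimates \<alpha> Y Q C1 C2 \<mu>1 \<mu>2)"

end

theory Submission
  imports Defs
begin

text \<open>
  The substitution \<open>\<tau> = sgn t |t|\<^sup>\<alpha> / \<alpha>\<close> turns the conformable equation into the ordinary
  linear equation \<open>x' = a(\<tau>) x\<close> on the whole line and \<open>E\<^sub>\<alpha>(\<mu>, t)\<close> into \<open>exp (\<mu> \<tau>)\<close>, so the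
  claim becomes the roughness of exponential dichotomies on a half-line, without any growth
  assumption on \<open>a\<close>. Let \<open>G\<close> be the Green function of the unperturbed equation,
  \<open>|G(t, s)| \<le> N exp (-\<beta> |t - s|)\<close>. The equation \<open>h = X P + \<integral> G b h\<close> has a solution decaying like
  \<open>exp (-\<beta> t / 2)\<close> by contraction, and \<open>Q = h(0) P\<close> is a projection with \<open>P Q = P\<close>. For the Green
  function \<open>W\<close> built from the perturbed fundamental matrix and \<open>Q\<close>, \<open>P Q = P\<close> and boundedness
  give \<open>W(t, s) = G(t, s) + \<integral> G(t, r) b(r) W(r, s) dr\<close>. For each fixed \<open>s\<close> the supremum \<open>M\<close> of
  \<open>exp (\<beta> |t - s| / 2) |W(t, s)|\<close> is finite, hence satisfies \<open>M \<le> N + M / 2\<close>, and so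
  \<open>M \<le> 2 N\<close> independently of \<open>s\<close>.
\<close>

subsection \<open>Matrix norms\<close>

text \<open>The library \<open>norm\<close> of a matrix is the Frobenius norm. Each entry of a
  product pairs a row with a column, so Cauchy-Schwarz, squared and summed over the entries, gives
  submultiplicativity with constant 1.\<close>

lemma norm_matrix_matrix_mult_le:
  fixes A :: "real^'n^'m" and B :: "real^'p^'n"
  shows "norm (A ** B) \<le> norm A * norm B"
proof -
  have sq: "(norm M)\<^sup>2 = (\<Sum>i\<in>UNIV. (norm (M $ i))\<^sup>2)" for M :: "real^'q^'r"
    by (simp add: norm_vec_def L2_set_def sum_nonneg)
  have col: "(norm B)\<^sup>2 = (\<Sum>j\<in>UNIV. (norm (column j B))\<^sup>2)"
    by (simp add: sq norm_vec_def L2_set_def sum_nonneg column_def) (rule sum.swap)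
  have "(norm (A ** B))\<^sup>2 = (\<Sum>i\<in>UNIV. \<Sum>j\<in>UNIV. ((A ** B) $ i $ j)\<^sup>2)"
    by (simp add: sq norm_vec_def L2_set_def sum_nonneg)
  also have "\<dots> \<le> (\<Sum>i\<in>UNIV. \<Sum>j\<in>UNIV. (norm (A $ i))\<^sup>2 * (norm (column j B))\<^sup>2)"
  proof (intro sum_mono)
    fix i j
    have "(A ** B) $ i $ j = A $ i \<bullet> column j B"
      by (simp add: matrix_matrix_mult_def inner_vec_def column_def)
    then have "\<bar>(A ** B) $ i $ j\<bar> \<le> norm (A $ i) * norm (column j B)"
      by (simp add: Cauchy_Schwarz_ineq2)
    then show "((A ** B) $ i $ j)\<^sup>2 \<le> (norm (A $ i))\<^sup>2 * (norm (column j B))\<^sup>2"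
      by (metis abs_le_square_iff abs_mult abs_norm_cancel power_mult_distrib)
  qed
  also have "\<dots> = (norm A * norm B)\<^sup>2"
    unfolding power_mult_distrib sq[of A] col sum_product ..
  finally show ?thesis
    by (rule power2_le_imp_le) simp
qed

lemma bounded_bilinear_matrix_matrix_mult:
  "bounded_bilinear ((**) :: real^'n^'m \<Rightarrow> real^'p^'n \<Rightarrow> real^'p^'m)"
proof
  show "\<exists>K. \<forall>A B. norm (A ** B :: real^'p^'m) \<le> norm A * norm (B :: real^'p^'n) * K"
    by (intro exI[of _ 1]) (simp add: norm_matrix_matrix_mult_le)
  show "(A + A') ** B = A ** B + A' ** B" for A A' :: "real^'n^'m" and B :: "real^'p^'n"
    by (simp add: matrix_matrix_mult_def vec_eq_iff sum.distrib distrib_right)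
qed (simp_all only: matrix_add_ldistrib matrix_scalar_ac scalar_matrix_assoc)

text \<open>Provides limits, continuity and the product rule for \<open>**\<close> under the prefix
  \<open>matmul\<close>.\<close>

interpretation matmul: bounded_bilinear "(**) :: real^'n^'m \<Rightarrow> real^'p^'n \<Rightarrow> real^'p^'m"
  by (rule bounded_bilinear_matrix_matrix_mult)

lemma matrix_inv_eqI:
  fixes A B :: "real^'n^'n"
  assumes "A ** B = mat 1"
  shows "matrix_inv B = A"
proof -
  have "B ** A = mat 1" using assms matrix_left_right_inverse by blast
  have "B ** matrix_inv B = mat 1 \<and> matrix_inv B ** B = mat 1"
    unfolding matrix_inv_def by (rule someI[of _ A]) (use assms \<open>B ** A = mat 1\<close> in auto)
  then show ?thesis
    by (metis assms matrix_mul_assoc matrix_mul_lid matrix_mul_rid)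
qed

text \<open>With the reverse comparison below, all estimates can be made in the Frobenius norm; the
  dimension is paid as a factor once on entry and once on return.\<close>

lemma colsum_norm_le_norm: "colsum_norm M \<le> real CARD('m) * norm (M :: real^'n^'m)"
proof -
  have "(\<Sum>i\<in>UNIV. \<bar>M $ i $ j\<bar>) \<le> real CARD('m) * norm M" for j
  proof -
    have "\<bar>M $ i $ j\<bar> \<le> norm M" for i
      using component_le_norm_cart[of "M $ i" j] Finite_Cartesian_Product.norm_nth_le[of M i] by linarith
    then have "(\<Sum>i\<in>(UNIV :: 'm set). \<bar>M $ i $ j\<bar>) \<le> (\<Sum>i\<in>(UNIV :: 'm set). norm M)"
      by (intro sum_mono)
    then show ?thesis by simp
  qed
  then show ?thesis
    by (auto simp: colsum_norm_def)
qed

lemma norm_le_colsum_norm: "norm (M :: real^'n^'m) \<le> real CARD('n) * colsum_norm M"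
proof -
  have "norm M \<le> (\<Sum>i\<in>UNIV. norm (M $ i))"
    by (simp add: norm_vec_def L2_set_le_sum)
  also have "\<dots> \<le> (\<Sum>i\<in>UNIV. \<Sum>j\<in>UNIV. \<bar>M $ i $ j\<bar>)"
    by (intro sum_mono norm_le_l1_cart)
  also have "\<dots> = (\<Sum>j\<in>UNIV. \<Sum>i\<in>UNIV. \<bar>M $ i $ j\<bar>)"
    by (rule sum.swap)
  also have "\<dots> \<le> (\<Sum>j\<in>(UNIV::'n set). colsum_norm M)"
    by (intro sum_mono) (auto simp: colsum_norm_def)
  finally show ?thesis by simp
qed

subsection \<open>Primitives and weighted fixed points\<close>

text \<open>Meaningful only for continuous \<open>f\<close>, where it is the primitive vanishing at 0.\<close>

definition primitive :: "(real \<Rightarrow> 'a::euclidean_space) \<Rightarrow> real \<Rightarrow> 'a" where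
  "primitive f = (SOME F. F 0 = 0 \<and> (\<forall>t. (F has_vector_derivative f t) (at t)))"

lemma primitive:
  assumes "continuous_on UNIV f"
  shows primitive_0: "primitive f 0 = 0"
    and has_vector_derivative_primitive: "(primitive f has_vector_derivative f t) (at t)"
proof -
  obtain F where F: "\<And>t. (F has_vector_derivative f t) (at t)"
    using einterval_antiderivative[of "-\<infinity>" "\<infinity>" f] assms
    by (auto simp: continuous_on_eq_continuous_at)
  have "((\<lambda>t. F t - F 0) has_vector_derivative f t) (at t)" for t
    using F by (simp add: has_vector_derivative_diff_const)
  then have "\<exists>F. F 0 = 0 \<and> (\<forall>t. (F has_vector_derivative f t) (at t))"
    by (intro exI[of _ "\<lambda>t. F t - F 0"]) auto
  from someI_ex[OF this] show "primitive f 0 = 0" "(primitive f has_vector_derivative f t) (at t)"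
    unfolding primitive_def by auto
qed

lemma continuous_on_primitive: "continuous_on UNIV f \<Longrightarrow> continuous_on S (primitive f)"
  by (meson continuous_at_imp_continuous_on has_vector_derivative_continuous
      has_vector_derivative_primitive)

text \<open>The mean value inequality with a real majorant. It takes the place of integral
  estimates: the increment of an antiderivative is bounded by that of an explicit \<phi>.\<close>

lemma norm_diff_le_of_derivative_le:
  fixes f :: "real \<Rightarrow> 'a::real_normed_vector" and \<phi> :: "real \<Rightarrow> real"
  assumes "a \<le> b" "continuous_on {a..b} f" "continuous_on {a..b} \<phi>"
    and "\<And>x. a < x \<Longrightarrow> x < b \<Longrightarrow> (f has_vector_derivative f' x) (at x)"
    and "\<And>x. a < x \<Longrightarrow> x < b \<Longrightarrow> (\<phi> has_real_derivative \<phi>' x) (at x)"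
    and "\<And>x. a < x \<Longrightarrow> x < b \<Longrightarrow> norm (f' x) \<le> \<phi>' x"
  shows "norm (f b - f a) \<le> \<phi> b - \<phi> a"
proof (cases "a = b")
  case False
  then show ?thesis
    using assms
    by (intro differentiable_bound_general[where f' = f' and \<phi>' = \<phi>'])
      (auto simp: has_real_derivative_iff_has_vector_derivative)
qed simp

text \<open>At \<open>c\<close> continuity is enough: the interval is cut there and the two bounds
  are added.\<close>

lemma norm_diff_le_of_derivative_le_except:
  fixes f :: "real \<Rightarrow> 'a::real_normed_vector" and \<phi> :: "real \<Rightarrow> real"
  assumes ab: "a \<le> b" and f: "continuous_on {a..b} f" and \<phi>: "continuous_on {a..b} \<phi>"
    and f': "\<And>x. a < x \<Longrightarrow> x < b \<Longrightarrow> x \<noteq> c \<Longrightarrow> (f has_vector_derivative f' x) (at x)"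
    and \<phi>': "\<And>x. a < x \<Longrightarrow> x < b \<Longrightarrow> (\<phi> has_real_derivative \<phi>' x) (at x)"
    and le: "\<And>x. a < x \<Longrightarrow> x < b \<Longrightarrow> norm (f' x) \<le> \<phi>' x"
  shows "norm (f b - f a) \<le> \<phi> b - \<phi> a"
proof (cases "a < c \<and> c < b")
  case True
  have "{a..c} \<subseteq> {a..b}" "{c..b} \<subseteq> {a..b}"
    using True by auto
  note cont = this[THEN continuous_on_subset[OF f]] this[THEN continuous_on_subset[OF \<phi>]]
  have "norm (f c - f a) \<le> \<phi> c - \<phi> a"
    by (rule norm_diff_le_of_derivative_le[OF _ cont(1,3) f' \<phi>' le]) (use True in auto)
  moreover have "norm (f b - f c) \<le> \<phi> b - \<phi> c"
    by (rule norm_diff_le_of_derivative_le[OF _ cont(2,4) f' \<phi>' le]) (use True in auto)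
  moreover have "norm (f b - f a) \<le> norm (f b - f c) + norm (f c - f a)"
    using norm_triangle_ineq[of "f b - f c" "f c - f a"] by simp
  ultimately show ?thesis by linarith
next
  case False
  show ?thesis
    by (rule norm_diff_le_of_derivative_le[OF ab f \<phi> f' \<phi>' le]) (use False in auto)
qed

lemma eq_of_derivative_zero:
  fixes f :: "real \<Rightarrow> 'a::real_normed_vector"
  assumes "a \<le> b" "continuous_on {a..b} f"
    and "\<And>x. a < x \<Longrightarrow> x < b \<Longrightarrow> (f has_vector_derivative 0) (at x)"
  shows "f b = f a"
  using norm_diff_le_of_derivative_le[of a b f "\<lambda>_. 0" "\<lambda>_. 0" "\<lambda>_. 0"] assms by auto

lemma constant_of_derivative_zero:
  fixes f :: "real \<Rightarrow> 'a::real_normed_vector"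
  assumes "\<And>x. (f has_vector_derivative 0) (at x)"
  shows "f a = f b"
proof -
  have "continuous_on S f" for S
    by (meson assms continuous_at_imp_continuous_on has_vector_derivative_continuous)
  then show ?thesis
    using assms eq_of_derivative_zero[of a b f] eq_of_derivative_zero[of b a f]
    by (metis linear)
qed

text \<open>Banach's theorem in the space of continuous functions with finite norm sup |h| / w.
  Writing h = w u identifies it with the complete space of bounded continuous functions.\<close>

lemma weighted_fixed_point:
  fixes \<Phi> :: "(real \<Rightarrow> 'a::banach) \<Rightarrow> real \<Rightarrow> 'a" and w :: "real \<Rightarrow> real"
  assumes w: "continuous_on UNIV w" "\<And>t. w t > 0" and c: "0 \<le> c" "c < 1"
    and maps: "\<And>h M. continuous_on UNIV h \<Longrightarrow> (\<And>t. norm (h t) \<le> M * w t) \<Longrightarrow>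
      continuous_on UNIV (\<Phi> h) \<and> (\<exists>M'. \<forall>t. norm (\<Phi> h t) \<le> M' * w t)"
    and contr: "\<And>h k M M' t. continuous_on UNIV h \<Longrightarrow> continuous_on UNIV k \<Longrightarrow>
      (\<And>t. norm (h t) \<le> M' * w t) \<Longrightarrow> (\<And>t. norm (k t) \<le> M' * w t) \<Longrightarrow>
      (\<And>t. norm (h t - k t) \<le> M * w t) \<Longrightarrow> norm (\<Phi> h t - \<Phi> k t) \<le> c * M * w t"
  obtains h C where "continuous_on UNIV h" "\<And>t. norm (h t) \<le> C * w t" "\<Phi> h = h"
proof -
  define up where "up u = (\<lambda>t. w t *\<^sub>R apply_bcontfun u t)" for u :: "real \<Rightarrow>\<^sub>C 'a"
  define T where "T u = Bcontfun (\<lambda>t. \<Phi> (up u) t /\<^sub>R w t)" for u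
  have w0: "w t \<noteq> 0" for t using w(2)[of t] by simp
  have cont_up: "continuous_on UNIV (up u)" for u
    unfolding up_def by (intro continuous_intros w continuous_on_apply_bcontfun)
  have bnd_up: "\<exists>M. \<forall>t. norm (up u t) \<le> M * w t" for u
  proof -
    obtain M where "norm (apply_bcontfun u t) \<le> M" for t
      using bounded_apply_bcontfun[of u] by (auto simp: bounded_iff)
    then have "norm (up u t) \<le> M * w t" for t
      using w(2)[of t] by (simp add: up_def mult.commute)
    then show ?thesis by blast
  qed
  have T: "apply_bcontfun (T u) = (\<lambda>t. \<Phi> (up u) t /\<^sub>R w t)" for u
  proof -
    obtain M where M: "\<And>t. norm (up u t) \<le> M * w t" using bnd_up by blast
    from maps[OF cont_up[of u] M] obtain M' where M': "continuous_on UNIV (\<Phi> (up u))"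
      "\<And>t. norm (\<Phi> (up u) t) \<le> M' * w t" by blast
    have "norm (\<Phi> (up u) t /\<^sub>R w t) \<le> M'" for t
      using M'(2)[of t] w(2)[of t] by (simp add: field_simps)
    then have "bounded (range (\<lambda>t. \<Phi> (up u) t /\<^sub>R w t))"
      by (auto simp: bounded_iff)
    moreover have "continuous_on UNIV (\<lambda>t. \<Phi> (up u) t /\<^sub>R w t)"
      by (intro continuous_intros M' w ballI w0)
    ultimately show ?thesis
      unfolding T_def by (intro Bcontfun_inverse) (auto simp: bcontfun_def)
  qed
  have "dist (T u) (T v) \<le> c * dist u v" for u v
  proof (rule dist_bound)
    fix t
    obtain M1 where M1: "\<And>t. norm (up u t) \<le> M1 * w t" using bnd_up by blast
    obtain M2 where M2: "\<And>t. norm (up v t) \<le> M2 * w t" using bnd_up by blast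
    \<comment> \<open>\<open>contr\<close> asks for one constant bounding both arguments, hence the
      maximum.\<close>
    have "M1 * w t \<le> max M1 M2 * w t" "M2 * w t \<le> max M1 M2 * w t" for t
      using w(2)[of t] by (auto intro: mult_right_mono)
    then have "norm (up u t) \<le> max M1 M2 * w t" "norm (up v t) \<le> max M1 M2 * w t" for t
      using M1[of t] M2[of t] order_trans by blast+
    moreover have "norm (up u t - up v t) \<le> dist u v * w t" for t
      using dist_bounded[of u t v] w(2)[of t]
      by (simp add: up_def dist_norm flip: scaleR_diff_right)
    ultimately have "norm (\<Phi> (up u) t - \<Phi> (up v) t) \<le> c * dist u v * w t"
      by (rule contr[OF cont_up cont_up])
    moreover have "dist (apply_bcontfun (T u) t) (apply_bcontfun (T v) t)
        = norm (\<Phi> (up u) t - \<Phi> (up v) t) / w t"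
      using w(2)[of t]
      by (simp add: T dist_norm divide_inverse mult.commute flip: scaleR_diff_right)
    ultimately show "dist (apply_bcontfun (T u) t) (apply_bcontfun (T v) t) \<le> c * dist u v"
      using w(2)[of t] by (simp add: pos_divide_le_eq)
  qed
  then obtain u where "T u = u"
    using banach_fix_type[of c T] c by blast
  then have "\<Phi> (up u) t /\<^sub>R w t = apply_bcontfun u t" for t
    using fun_cong[OF T[of u]] by simp
  then have "up u t = w t *\<^sub>R (\<Phi> (up u) t /\<^sub>R w t)" for t
    by (simp add: up_def)
  then have "\<Phi> (up u) = up u"
    using w0 by (simp add: fun_eq_iff)
  moreover obtain M where "\<And>t. norm (up u t) \<le> M * w t" using bnd_up by blast
  ultimately show ?thesis
    using that[OF cont_up] by blast
qed

subsection \<open>Linear matrix differential equations\<close>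

lemmas matmul_distribs = matmul.add_left matmul.add_right matmul.diff_left matmul.diff_right
  matmul.minus_left matmul.minus_right

lemma bounded_linear_transpose: "bounded_linear (transpose :: real^'n^'m \<Rightarrow> real^'m^'n)"
  by (intro linear_conv_bounded_linear[THEN iffD1] linearI) (auto simp: transpose_def vec_eq_iff)

lemma linear_ode_exists:
  fixes c :: "real \<Rightarrow> real^'n^'n"
  assumes c: "continuous_on UNIV c"
  obtains Y where "Y 0 = mat 1" "\<And>t. (Y has_vector_derivative c t ** Y t) (at t)"
proof -
  define \<phi> where "\<phi> = primitive (\<lambda>t. norm (c t))"
  \<comment> \<open>With this weight the Picard map is a \<open>1/2\<close>-contraction on the whole line at once.\<close>
  define w where "w t = exp (2 * \<bar>\<phi> t\<bar>)" for t
  define \<Phi> where "\<Phi> h t = mat 1 + primitive (\<lambda>t. c t ** h t) t" for h t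
  have nc: "continuous_on UNIV (\<lambda>t. norm (c t))"
    using c by (intro continuous_intros)
  have \<phi>': "(\<phi> has_real_derivative norm (c t)) (at t)" for t
    unfolding \<phi>_def has_real_derivative_iff_has_vector_derivative
    by (rule has_vector_derivative_primitive[OF nc])
  have \<phi>0: "\<phi> 0 = 0"
    unfolding \<phi>_def by (rule primitive_0[OF nc])
  have \<phi>c: "continuous_on S \<phi>" for S
    unfolding \<phi>_def by (rule continuous_on_primitive[OF nc])
  have \<phi>_mono: "\<phi> x \<le> \<phi> y" if "x \<le> y" for x y
    by (rule DERIV_nonneg_imp_nondecreasing[OF that]) (use \<phi>' norm_ge_zero in blast)
  have ch: "continuous_on UNIV (\<lambda>t. c t ** h t)" if "continuous_on UNIV h" for h :: "real \<Rightarrow> real^'n^'n"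
    by (intro matmul.continuous_on c that)
  have w: "continuous_on UNIV w" "\<And>t. w t > 0"
    by (auto simp: w_def intro!: continuous_intros \<phi>c)
  have w1: "w t \<ge> 1" for t
    by (simp add: w_def)
  \<comment> \<open>Since \<phi>' = |c|, the function exp (2 \<phi>) / 2 is an antiderivative of exp
    (2 \<phi>) |c|; this 1/2 is the contraction factor. For t < 0, where \<phi> \<le> 0, the same
    role falls to - exp (- 2 \<phi>) / 2.\<close>
  have bound: "norm (G t) \<le> 1/2 * M * w t"
    if G: "\<And>t. (G has_vector_derivative c t ** g t) (at t)" "G 0 = 0"
      and g: "\<And>t. norm (g t) \<le> M * w t" for G g :: "real \<Rightarrow> real^'n^'n" and M t
  proof -
    have Gc: "continuous_on S G" for S
      by (meson G(1) continuous_at_imp_continuous_on has_vector_derivative_continuous)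
    have "M \<ge> 0"
      using order_trans[OF norm_ge_zero g[of 0]] by (simp add: w_def \<phi>0)
    have le: "norm (c r ** g r) \<le> M * w r * norm (c r)" for r
    proof -
      have "norm (c r ** g r) \<le> norm (c r) * norm (g r)"
        by (rule norm_matrix_matrix_mult_le)
      also have "\<dots> \<le> norm (c r) * (M * w r)"
        by (intro mult_left_mono g) auto
      finally show ?thesis by (simp add: mult.commute)
    qed
    show ?thesis
    proof (cases "t \<ge> 0")
      case True
      have "norm (G t - G 0) \<le> M / 2 * exp (2 * \<phi> t) - M / 2 * exp (2 * \<phi> 0)"
      proof (rule norm_diff_le_of_derivative_le[OF True Gc _ G(1)])
        show "continuous_on {0..t} (\<lambda>t. M / 2 * exp (2 * \<phi> t))"
          by (intro continuous_intros \<phi>c)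
        show "((\<lambda>t. M / 2 * exp (2 * \<phi> t)) has_real_derivative M * exp (2 * \<phi> r) * norm (c r)) (at r)" for r
          by (auto intro!: derivative_eq_intros \<phi>')
        show "norm (c r ** g r) \<le> M * exp (2 * \<phi> r) * norm (c r)" if "0 < r" for r
          using le[of r] \<phi>_mono[of 0 r] that by (simp add: w_def \<phi>0)
      qed
      then show ?thesis
        using \<open>M \<ge> 0\<close> \<phi>_mono[OF True] by (simp add: G(2) \<phi>0 w_def)
    next
      case False
      then have "t \<le> 0" by simp
      have "norm (G 0 - G t) \<le> - (M / 2) * exp (- 2 * \<phi> 0) - (- (M / 2) * exp (- 2 * \<phi> t))"
      proof (rule norm_diff_le_of_derivative_le[OF \<open>t \<le> 0\<close> Gc _ G(1)])
        show "continuous_on {t..0} (\<lambda>t. - (M / 2) * exp (- 2 * \<phi> t))"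
          by (intro continuous_intros \<phi>c)
        show "((\<lambda>t. - (M / 2) * exp (- 2 * \<phi> t)) has_real_derivative M * exp (- 2 * \<phi> r) * norm (c r)) (at r)" for r
          by (auto intro!: derivative_eq_intros \<phi>')
        show "norm (c r ** g r) \<le> M * exp (- 2 * \<phi> r) * norm (c r)" if "r < 0" for r
          using le[of r] \<phi>_mono[of r 0] that by (simp add: w_def \<phi>0)
      qed
      then show ?thesis
        using \<open>M \<ge> 0\<close> \<phi>_mono[OF \<open>t \<le> 0\<close>] by (simp add: G(2) \<phi>0 w_def)
    qed
  qed
  obtain Y C where Y: "continuous_on UNIV Y" "\<And>t. norm (Y t) \<le> C * w t" "\<Phi> Y = Y"
  proof (rule weighted_fixed_point[of w "1/2" \<Phi>])
    fix h :: "real \<Rightarrow> real^'n^'n" and M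
    assume h: "continuous_on UNIV h" "\<And>t. norm (h t) \<le> M * w t"
    have "norm (\<Phi> h t) \<le> (norm (mat 1 :: real^'n^'n) + 1/2 * M) * w t" for t
    proof -
      have "norm (\<Phi> h t) \<le> norm (mat 1 :: real^'n^'n) * 1 + 1/2 * M * w t"
        unfolding \<Phi>_def
        using bound[OF has_vector_derivative_primitive[OF ch[OF h(1)]] primitive_0[OF ch[OF h(1)]] h(2)]
          norm_triangle_ineq[of "mat 1" "primitive (\<lambda>t. c t ** h t) t"] by (smt (verit))
      also have "\<dots> \<le> norm (mat 1 :: real^'n^'n) * w t + 1/2 * M * w t"
        using w1[of t] by (intro add_right_mono mult_left_mono) auto
      finally show ?thesis by (simp add: distrib_right)
    qed
    moreover have "continuous_on UNIV (\<Phi> h)"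
      unfolding \<Phi>_def by (intro continuous_intros continuous_on_primitive ch h)
    ultimately show "continuous_on UNIV (\<Phi> h) \<and> (\<exists>M'. \<forall>t. norm (\<Phi> h t) \<le> M' * w t)"
      by blast
  next
    fix h k :: "real \<Rightarrow> real^'n^'n" and M t
    assume h: "continuous_on UNIV h" and k: "continuous_on UNIV k"
      and hk: "\<And>t. norm (h t - k t) \<le> M * w t"
    have "((\<lambda>t. primitive (\<lambda>t. c t ** h t) t - primitive (\<lambda>t. c t ** k t) t)
        has_vector_derivative c t ** (h t - k t)) (at t)" for t
      unfolding matmul.diff_right
      by (intro has_vector_derivative_diff has_vector_derivative_primitive ch h k)
    from bound[OF this _ hk, of t] show "norm (\<Phi> h t - \<Phi> k t) \<le> 1/2 * M * w t"
      by (simp add: \<Phi>_def primitive_0 ch h k)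
  qed (use w in auto)
  have "Y 0 = \<Phi> Y 0" by (simp add: Y(3))
  then have "Y 0 = mat 1"
    by (simp add: \<Phi>_def primitive_0 ch Y(1))
  moreover have "(\<Phi> Y has_vector_derivative 0 + c t ** Y t) (at t)" for t
    unfolding \<Phi>_def
    by (intro has_vector_derivative_add has_vector_derivative_const
        has_vector_derivative_primitive ch Y)
  ultimately show ?thesis
    using that Y(3) by auto
qed

text \<open>The inverse comes from the adjoint equation: the transpose \<open>Z\<close> of its
  solution satisfies (Z X)' = 0, so \<open>Z ** X\<close> keeps its value at 0, and a left inverse
  of a square matrix is also a right inverse.\<close>

lemma linear_ode_inverse:
  fixes c X :: "real \<Rightarrow> real^'n^'n"
  assumes c: "continuous_on UNIV c" and X0: "X 0 = mat 1"
    and X: "\<And>t. (X has_vector_derivative c t ** X t) (at t)"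
  obtains Z where "\<And>t. (Z has_vector_derivative - (Z t ** c t)) (at t)"
    "\<And>t. Z t ** X t = mat 1" "\<And>t. X t ** Z t = mat 1"
proof -
  have "continuous_on UNIV (\<lambda>t. - transpose (c t))"
    by (intro continuous_intros bounded_linear.continuous_on[OF bounded_linear_transpose] c)
  then obtain W where W0: "W 0 = mat 1"
    and W: "\<And>t. (W has_vector_derivative - transpose (c t) ** W t) (at t)"
    using linear_ode_exists by blast
  define Z where "Z t = transpose (W t)" for t
  have Z: "(Z has_vector_derivative - (Z t ** c t)) (at t)" for t
  proof -
    have "(Z has_vector_derivative transpose (- transpose (c t) ** W t)) (at t)"
      unfolding Z_def by (rule bounded_linear.has_vector_derivative[OF bounded_linear_transpose W])
    moreover have "transpose (- transpose (c t) ** W t) = - (Z t ** c t)"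
      by (simp add: Z_def matmul.minus_left matrix_transpose_mul
          linear_neg[OF bounded_linear.linear[OF bounded_linear_transpose]])
    ultimately show ?thesis by simp
  qed
  have "((\<lambda>t. Z t ** X t) has_vector_derivative Z t ** (c t ** X t) + - (Z t ** c t) ** X t) (at t)" for t
    by (intro matmul.has_vector_derivative Z X)
  then have "((\<lambda>t. Z t ** X t) has_vector_derivative 0) (at t)" for t
    by (simp add: matmul.minus_left matrix_mul_assoc)
  then have "Z t ** X t = Z 0 ** X 0" for t
    by (rule constant_of_derivative_zero)
  then have ZX: "Z t ** X t = mat 1" for t
    by (simp add: Z_def W0 X0)
  then show ?thesis
    using that[OF Z ZX] matrix_left_right_inverse by blast
qed

subsection \<open>Exponential dichotomies\<close>

lemma has_vector_derivative_matmul_left: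
  fixes A :: "real^'n^'m" and F :: "real \<Rightarrow> real^'p^'n"
  assumes "(F has_vector_derivative F') (at r)"
  shows "((\<lambda>r. A ** F r) has_vector_derivative A ** F') (at r)"
  using bounded_linear.has_vector_derivative[OF matmul.bounded_linear_right assms] .

text \<open>\<open>Z\<close> is the inverse of \<open>X\<close>, carried with its own equation so
  that products with \<open>Z\<close> can be differentiated directly.\<close>

locale exponential_dichotomy =
  fixes a X Z :: "real \<Rightarrow> real^'n^'n" and P :: "real^'n^'n" and N \<beta> :: real
  assumes X: "\<And>t. (X has_vector_derivative a t ** X t) (at t)"
    and Z: "\<And>t. (Z has_vector_derivative - (Z t ** a t)) (at t)"
    and ZX: "\<And>t. Z t ** X t = mat 1" and XZ: "\<And>t. X t ** Z t = mat 1"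
    and X0: "X 0 = mat 1" and PP: "P ** P = P"
    and \<beta>: "\<beta> > 0"
    and stable: "\<And>s t. 0 \<le> s \<Longrightarrow> s \<le> t \<Longrightarrow> norm (X t ** P ** Z s) \<le> N * exp (- \<beta> * (t - s))"
    and unstable: "\<And>s t. 0 \<le> t \<Longrightarrow> t \<le> s \<Longrightarrow>
      norm (X t ** (mat 1 - P) ** Z s) \<le> N * exp (- \<beta> * (s - t))"
begin

lemma Z0: "Z 0 = mat 1"
  using ZX[of 0] by (simp add: X0)

lemma N_nonneg: "N \<ge> 0"
  using order_trans[OF norm_ge_zero stable[of 0 0]] by simp

lemma continuous_X: "continuous_on S X"
  by (rule continuous_on_vector_derivative[OF has_vector_derivative_at_within[OF X]])

lemma continuous_Z: "continuous_on S Z"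
  by (rule continuous_on_vector_derivative[OF has_vector_derivative_at_within[OF Z]])

lemma P_compl: "P ** (mat 1 - P) = 0" "(mat 1 - P) ** P = 0"
  by (simp_all add: matmul_distribs PP)

text \<open>The kernel decays at rate \<beta>, but only \<beta> / 2 is kept in the result: one half
  is spent on the triangle inequality |t - s| \<le> |t - r| + |r - s|, the other remains as a factor
  integrable in \<open>r\<close>.\<close>

lemma weight_le:
  fixes A g :: "real^'n^'n"
  assumes "0 \<le> M" "norm A \<le> N * exp (- \<beta> * \<bar>t - r\<bar>)" "norm g \<le> M * exp (- (\<beta> / 2) * \<bar>r - s\<bar>)"
  shows "norm (A ** g) \<le> N * M * exp (- (\<beta> / 2) * \<bar>t - s\<bar>) * exp (- (\<beta> / 2) * \<bar>t - r\<bar>)"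
proof -
  have "norm (A ** g) \<le> norm A * norm g"
    by (rule norm_matrix_matrix_mult_le)
  also have "\<dots> \<le> (N * exp (- \<beta> * \<bar>t - r\<bar>)) * (M * exp (- (\<beta> / 2) * \<bar>r - s\<bar>))"
    using N_nonneg assms by (intro mult_mono) auto
  also have "\<dots> = N * M * exp (- \<beta> * \<bar>t - r\<bar> + - (\<beta> / 2) * \<bar>r - s\<bar>)"
    by (simp only: exp_add mult_ac)
  also have "\<dots> \<le> N * M * exp (- (\<beta> / 2) * \<bar>t - s\<bar> + - (\<beta> / 2) * \<bar>t - r\<bar>)"
  proof -
    have "\<beta> / 2 * \<bar>t - s\<bar> \<le> \<beta> / 2 * (\<bar>t - r\<bar> + \<bar>r - s\<bar>)"
      using \<beta> by (intro mult_left_mono) auto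
    then have "- \<beta> * \<bar>t - r\<bar> + - (\<beta> / 2) * \<bar>r - s\<bar>
        \<le> - (\<beta> / 2) * \<bar>t - s\<bar> + - (\<beta> / 2) * \<bar>t - r\<bar>"
      by (simp add: field_simps)
    then show ?thesis
      using N_nonneg assms(1) by (intro mult_left_mono) auto
  qed
  also have "\<dots> = N * M * exp (- (\<beta> / 2) * \<bar>t - s\<bar>) * exp (- (\<beta> / 2) * \<bar>t - r\<bar>)"
    by (simp only: exp_add mult_ac)
  finally show ?thesis .
qed

section \<open>Stable and unstable integrals against an exponentially weighted function\<close>

context
  fixes F g :: "real \<Rightarrow> real^'n^'n" and s M :: real
  assumes F: "continuous_on {0..} F"
    and F': "\<And>r. 0 < r \<Longrightarrow> r \<noteq> s \<Longrightarrow> (F has_vector_derivative Z r ** g r) (at r)"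
    and g: "\<And>r. 0 < r \<Longrightarrow> norm (g r) \<le> M * exp (- (\<beta> / 2) * \<bar>r - s\<bar>)"
begin

lemma M_nonneg: "M \<ge> 0"
  using order_trans[OF norm_ge_zero g[of 1]] by (simp add: zero_le_mult_iff)

lemma continuous_on_mult_left:
  assumes "0 \<le> u"
  shows "continuous_on {u..v} (\<lambda>r. A ** F r)"
  by (intro matmul.continuous_on continuous_on_const continuous_on_subset[OF F]) (use assms in auto)

text \<open>In the next three lemmas \<open>F\<close> plays the role of \<open>r \<mapsto> \<integral>\<^sub>0\<^sup>r Z g\<close>; the point \<open>s\<close> is
  exceptional because \<open>g\<close> will be \<open>b\<close> times a Green function jumping there.\<close>

lemma stable_integral_bound:
  assumes "0 \<le> t"
  shows "norm (X t ** P ** (F t - F 0)) \<le> 2 * N * M / \<beta> * exp (- (\<beta> / 2) * \<bar>t - s\<bar>)"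
proof -
  define K where "K = N * M * exp (- (\<beta> / 2) * \<bar>t - s\<bar>)"
  have "K \<ge> 0" by (simp add: K_def N_nonneg M_nonneg)
  \<comment> \<open>An antiderivative of the majorant
    \<open>K * exp (- (\<beta> / 2) * (t - r))\<close>; the factor 2 / \<beta> bounds the mass of
    this exponential kernel.\<close>
  define \<psi> where "\<psi> r = 2 * K / \<beta> * exp (- (\<beta> / 2) * (t - r))" for r
  have "norm (X t ** P ** F t - X t ** P ** F 0) \<le> \<psi> t - \<psi> 0"
  proof (rule norm_diff_le_of_derivative_le_except[where c = s])
    show "continuous_on {0..t} (\<lambda>r. X t ** P ** F r)"
      by (rule continuous_on_mult_left) (use assms in auto)
    show "continuous_on {0..t} \<psi>"
      unfolding \<psi>_def by (intro continuous_intros)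
    show "((\<lambda>r. X t ** P ** F r) has_vector_derivative X t ** P ** (Z r ** g r)) (at r)"
      if "0 < r" "r \<noteq> s" for r
      by (rule has_vector_derivative_matmul_left[OF F'[OF that]])
    show "(\<psi> has_real_derivative K * exp (- (\<beta> / 2) * (t - r))) (at r)" for r
      unfolding \<psi>_def using \<beta> by (auto intro!: derivative_eq_intros)
    show "norm (X t ** P ** (Z r ** g r)) \<le> K * exp (- (\<beta> / 2) * (t - r))" if "0 < r" "r < t" for r
      using weight_le[OF M_nonneg _ g, of "X t ** P ** Z r" t r] stable[of r t] that
      by (simp add: K_def matrix_mul_assoc)
  qed fact
  also have "\<dots> \<le> \<psi> t"
    using \<open>K \<ge> 0\<close> \<beta> by (simp add: \<psi>_def)
  finally show ?thesis
    by (simp add: matmul.diff_right \<psi>_def K_def)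
qed

lemma unstable_integral_bound:
  assumes "0 \<le> t" "t \<le> T"
  shows "norm (X t ** (mat 1 - P) ** (F T - F t)) \<le> 2 * N * M / \<beta> * exp (- (\<beta> / 2) * \<bar>t - s\<bar>)"
proof -
  define K where "K = N * M * exp (- (\<beta> / 2) * \<bar>t - s\<bar>)"
  have "K \<ge> 0" by (simp add: K_def N_nonneg M_nonneg)
  \<comment> \<open>The kernel now decays as \<open>r\<close> grows, so the increasing
    antiderivative is negative, and its increment stays below \<open>2 * K / \<beta>\<close> for
    every \<open>T\<close>.\<close>
  define \<psi> where "\<psi> r = - (2 * K / \<beta>) * exp (- (\<beta> / 2) * (r - t))" for r
  have "norm (X t ** (mat 1 - P) ** F T - X t ** (mat 1 - P) ** F t) \<le> \<psi> T - \<psi> t"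
  proof (rule norm_diff_le_of_derivative_le_except[where c = s])
    show "continuous_on {t..T} (\<lambda>r. X t ** (mat 1 - P) ** F r)"
      by (rule continuous_on_mult_left) (use assms in auto)
    show "continuous_on {t..T} \<psi>"
      unfolding \<psi>_def by (intro continuous_intros)
    show "((\<lambda>r. X t ** (mat 1 - P) ** F r) has_vector_derivative X t ** (mat 1 - P) ** (Z r ** g r)) (at r)"
      if "t < r" "r \<noteq> s" for r
      using assms that by (intro has_vector_derivative_matmul_left F') auto
    show "(\<psi> has_real_derivative K * exp (- (\<beta> / 2) * (r - t))) (at r)" for r
      unfolding \<psi>_def using \<beta> by (auto intro!: derivative_eq_intros)
    show "norm (X t ** (mat 1 - P) ** (Z r ** g r)) \<le> K * exp (- (\<beta> / 2) * (r - t))"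
      if "t < r" "r < T" for r
      using weight_le[OF M_nonneg _ g, of "X t ** (mat 1 - P) ** Z r" t r] unstable[of t r] that assms
      by (simp add: K_def matrix_mul_assoc abs_minus_commute[of t r])
  qed fact
  also have "\<dots> \<le> 2 * K / \<beta>"
    using \<open>K \<ge> 0\<close> \<beta> by (simp add: \<psi>_def)
  finally show ?thesis
    by (simp add: matmul.diff_right K_def)
qed

lemma unstable_integral_convergent: "convergent (\<lambda>n. (mat 1 - P) ** F (real n))"
proof -
  define K where "K = N * M / \<beta>"
  have K: "K \<ge> 0" using \<beta> by (simp add: K_def N_nonneg M_nonneg)
  \<comment> \<open>\<open>unstable\<close> at time 0, where \<open>X\<close> is the identity, makes
    \<open>(mat 1 - P) ** Z r\<close> decay like \<open>exp (- \<beta> * r)\<close>, while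
    \<open>g\<close> is bounded by \<open>M\<close>. The resulting tail bound is the Cauchy
    property.\<close>
  have tail: "norm ((mat 1 - P) ** F v - (mat 1 - P) ** F u) \<le> K * exp (- \<beta> * u)" if "0 \<le> u" "u \<le> v" for u v
  proof -
    have "norm ((mat 1 - P) ** F v - (mat 1 - P) ** F u) \<le> - K * exp (- \<beta> * v) - (- K * exp (- \<beta> * u))"
    proof (rule norm_diff_le_of_derivative_le_except[where c = s])
      show "continuous_on {u..v} (\<lambda>r. (mat 1 - P) ** F r)"
        by (rule continuous_on_mult_left) (use that in auto)
      show "continuous_on {u..v} (\<lambda>r. - K * exp (- \<beta> * r))"
        by (intro continuous_intros)
      show "((\<lambda>r. (mat 1 - P) ** F r) has_vector_derivative (mat 1 - P) ** (Z r ** g r)) (at r)"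
        if "u < r" "r \<noteq> s" for r
        using that \<open>0 \<le> u\<close> by (intro has_vector_derivative_matmul_left F') auto
      show "((\<lambda>r. - K * exp (- \<beta> * r)) has_real_derivative N * M * exp (- \<beta> * r)) (at r)" for r
        using \<beta> by (auto intro!: derivative_eq_intros simp: K_def)
      show "norm ((mat 1 - P) ** (Z r ** g r)) \<le> N * M * exp (- \<beta> * r)" if "u < r" for r
      proof -
        have r: "0 < r" using that \<open>0 \<le> u\<close> by simp
        have "norm ((mat 1 - P) ** (Z r ** g r)) \<le> norm ((mat 1 - P) ** Z r) * norm (g r)"
          by (simp add: matrix_mul_assoc norm_matrix_matrix_mult_le)
        also have "\<dots> \<le> (N * exp (- \<beta> * r)) * M"
        proof (rule mult_mono)
          show "norm ((mat 1 - P) ** Z r) \<le> N * exp (- \<beta> * r)"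
            using unstable[of 0 r] r by (simp add: X0)
          have "M * exp (- (\<beta> / 2) * \<bar>r - s\<bar>) \<le> M * 1"
            using \<beta> M_nonneg by (intro mult_left_mono) auto
          then show "norm (g r) \<le> M"
            using g[OF r] by simp
        qed (simp_all add: N_nonneg)
        finally show ?thesis by (simp add: mult_ac)
      qed
    qed (use that in auto)
    then show ?thesis
      using mult_nonneg_nonneg[OF K exp_ge_zero[of "- \<beta> * v"]] by linarith
  qed
  have lim: "(\<lambda>n. K * exp (- \<beta> * real n)) \<longlonglongrightarrow> 0"
  proof -
    have "(\<lambda>n. K * exp (- \<beta>) ^ n) \<longlonglongrightarrow> K * 0"
      using \<beta> by (intro tendsto_intros LIMSEQ_power_zero) auto
    then show ?thesis
      by (simp only: exp_of_nat2_mult mult_zero_right)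
  qed
  show ?thesis
  proof (rule Cauchy_convergent, rule metric_CauchyI)
    fix e :: real assume "e > 0"
    then have "e / 2 > 0" by simp
    then obtain n0 where n0: "\<And>n. n \<ge> n0 \<Longrightarrow> norm (K * exp (- \<beta> * real n)) < e / 2"
      using LIMSEQ_D[OF lim \<open>e / 2 > 0\<close>] by auto
    have close: "dist ((mat 1 - P) ** F (real n)) ((mat 1 - P) ** F (real n0)) < e / 2" if "n \<ge> n0" for n
      using tail[of n0 n] n0[of n0] that by (simp add: dist_norm)
    have "dist ((mat 1 - P) ** F (real m)) ((mat 1 - P) ** F (real n)) < e"
      if "m \<ge> n0" "n \<ge> n0" for m n
      by (rule dist_triangle_half_l[OF close[OF that(1)] close[OF that(2)]])
    then show "\<exists>n0. \<forall>m\<ge>n0. \<forall>n\<ge>n0.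
        dist ((mat 1 - P) ** F (real m)) ((mat 1 - P) ** F (real n)) < e"
      by blast
  qed
qed

end

text \<open>\<open>X (F - J)\<close> is the solution of \<open>x' = a x + g\<close> that decays and whose initial value is in
  the kernel of \<open>P\<close>: \<open>J\<close> removes the growing component of \<open>X F\<close>.\<close>

lemma green_bound:
  fixes F g :: "real \<Rightarrow> real^'n^'n"
  assumes F: "continuous_on {0..} F" "F 0 = 0"
    and F': "\<And>r. 0 < r \<Longrightarrow> (F has_vector_derivative Z r ** g r) (at r)"
    and g: "\<And>r. 0 < r \<Longrightarrow> norm (g r) \<le> M * exp (- (\<beta> / 2) * r)"
    and J: "(\<lambda>n. (mat 1 - P) ** F (real n)) \<longlonglongrightarrow> J"
    and t: "0 \<le> t"
  shows "P ** J = 0" and "norm (X t ** (F t - J)) \<le> 4 * N * M / \<beta> * exp (- (\<beta> / 2) * t)"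
proof -
  have g': "norm (g r) \<le> M * exp (- (\<beta> / 2) * \<bar>r - 0\<bar>)" if "0 < r" for r
    using g[OF that] that by simp
  have F'': "(F has_vector_derivative Z r ** g r) (at r)" if "0 < r" "r \<noteq> 0" for r
    using F'[OF that(1)] .
  have "(\<lambda>n. P ** ((mat 1 - P) ** F (real n))) \<longlonglongrightarrow> P ** J"
    by (intro matmul.tendsto tendsto_const J)
  then have "(\<lambda>n. 0) \<longlonglongrightarrow> P ** J"
    by (simp add: matrix_mul_assoc P_compl)
  then show PJ: "P ** J = 0"
    by (simp add: LIMSEQ_const_iff)
  have "(\<lambda>n. X t ** ((mat 1 - P) ** F (real n)) - X t ** (mat 1 - P) ** F t)
      \<longlonglongrightarrow> X t ** J - X t ** (mat 1 - P) ** F t"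
    by (intro tendsto_diff matmul.tendsto tendsto_const J)
  then have "(\<lambda>n. X t ** (mat 1 - P) ** (F (real n) - F t)) \<longlonglongrightarrow> X t ** J - X t ** (mat 1 - P) ** F t"
    by (simp add: matmul.diff_right matrix_mul_assoc)
  moreover have "\<forall>\<^sub>F n in sequentially. norm (X t ** (mat 1 - P) ** (F (real n) - F t))
      \<le> 2 * N * M / \<beta> * exp (- (\<beta> / 2) * t)"
    using eventually_ge_at_top[of "nat \<lceil>t\<rceil>"]
  proof eventually_elim
    case (elim n)
    then have "t \<le> real n" by linarith
    from unstable_integral_bound[OF F(1) F'' g' t this] show ?case using t by simp
  qed
  ultimately have "norm (X t ** J - X t ** (mat 1 - P) ** F t) \<le> 2 * N * M / \<beta> * exp (- (\<beta> / 2) * t)"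
    by (rule Lim_norm_ubound[OF sequentially_bot])
  moreover have "norm (X t ** P ** (F t - F 0)) \<le> 2 * N * M / \<beta> * exp (- (\<beta> / 2) * t)"
    using stable_integral_bound[OF F(1) F'' g' t] t by simp
  \<comment> \<open>Splitting by the projections: the stable part is the integral over [0, t], the
    unstable part is minus the integral over [t, \<infinity>). Each contributes half of the constant
    4 N M / \<beta>.\<close>
  moreover have "X t ** (F t - J) = X t ** P ** (F t - F 0) - (X t ** J - X t ** (mat 1 - P) ** F t)"
    by (simp add: F(2) matmul_distribs)
  ultimately have "norm (X t ** (F t - J)) \<le>
      2 * N * M / \<beta> * exp (- (\<beta> / 2) * t) + 2 * N * M / \<beta> * exp (- (\<beta> / 2) * t)"
    by (simp only:) (rule order_trans[OF norm_triangle_ineq4 add_mono])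
  then show "norm (X t ** (F t - J)) \<le> 4 * N * M / \<beta> * exp (- (\<beta> / 2) * t)"
    by (simp add: mult_ac)
qed

end

subsection \<open>Roughness\<close>

locale perturbed_dichotomy = exponential_dichotomy a X Z P N \<beta>
  for a X Z :: "real \<Rightarrow> real^'n^'n" and P :: "real^'n^'n" and N \<beta> :: real +
  fixes b Y V :: "real \<Rightarrow> real^'n^'n" and \<epsilon> :: real
  assumes b: "continuous_on UNIV b"
    and b_le: "\<And>t. 0 \<le> t \<Longrightarrow> norm (b t) \<le> \<epsilon>"
    and small: "8 * N * \<epsilon> \<le> \<beta>"
    and Y: "\<And>t. (Y has_vector_derivative (a t + b t) ** Y t) (at t)"
    and V: "\<And>t. (V has_vector_derivative - (V t ** (a t + b t))) (at t)"
    and VY: "\<And>t. V t ** Y t = mat 1" and YV: "\<And>t. Y t ** V t = mat 1"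
    and Y0: "Y 0 = mat 1"
begin

lemma V0: "V 0 = mat 1"
  using VY[of 0] by (simp add: Y0)

lemma \<epsilon>_nonneg: "\<epsilon> \<ge> 0"
  using order_trans[OF norm_ge_zero b_le[of 0]] by simp

lemma continuous_Y: "continuous_on S Y"
  by (rule continuous_on_vector_derivative[OF has_vector_derivative_at_within[OF Y]])

text \<open>\<open>4 * N / \<beta>\<close> is the constant of \<open>green_bound\<close> for the
  Green operator, so multiplication by \<open>b\<close> followed by that operator halves weighted
  bounds. This explains the 8 in \<open>small\<close>.\<close>

lemma contraction_le:
  assumes "M \<ge> 0"
  shows "4 * N * (\<epsilon> * M) / \<beta> \<le> M / 2"
  using mult_right_mono[OF small assms] \<beta> by (simp add: field_simps)

lemma norm_b_mult_le:
  assumes "0 \<le> t" "norm (B :: real^'n^'n) \<le> K"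
  shows "norm (b t ** B) \<le> \<epsilon> * K"
proof -
  have "norm (b t ** B) \<le> norm (b t) * norm B"
    by (rule norm_matrix_matrix_mult_le)
  also have "\<dots> \<le> \<epsilon> * K"
    using assms b_le \<epsilon>_nonneg by (intro mult_mono) auto
  finally show ?thesis .
qed

text \<open>The fixed point solves the perturbed equation on the half-line, so it equals
  \<open>Y t ** k 0\<close> there and passes its decay on to \<open>Y\<close>. From
  \<open>k 0 = P - L h\<close> and \<open>P ** L h = 0\<close> follows \<open>P ** k 0 = P\<close>,
  which together with \<open>P ** P = P\<close> makes \<open>k 0 ** P\<close> idempotent.\<close>

lemma decaying_projection:
  obtains Q C where "P ** Q = P" "Q ** Q = Q"
    "\<And>t. 0 \<le> t \<Longrightarrow> norm (Y t ** Q) \<le> C * exp (- (\<beta> / 2) * t)"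
proof -
  define G where "G h = primitive (\<lambda>r. Z r ** (b r ** h r))" for h :: "real \<Rightarrow> real^'n^'n"
  \<comment> \<open>The unstable integral over the whole half-line, which is \<open>J\<close> in
    \<open>green_bound\<close>. Convergence is shown for \<open>h\<close> bounded by a multiple of
    \<open>w\<close>.\<close>
  define L where "L h = lim (\<lambda>n. (mat 1 - P) ** G h (real n))" for h :: "real \<Rightarrow> real^'n^'n"
  \<comment> \<open>The fixed point theorem is set on the whole line; \<open>max t 0\<close> extends
    the half-line problem to negative times by the value at 0.\<close>
  define w where "w t = exp (- (\<beta> / 2) * max t 0)" for t
  define \<Phi> where "\<Phi> h t = X (max t 0) ** (P + G h (max t 0) - L h)" for h :: "real \<Rightarrow> real^'n^'n" and t
  have w: "continuous_on UNIV w" "\<And>t. w t > 0"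
    by (auto simp: w_def intro!: continuous_intros)
  have cont: "continuous_on UNIV (\<lambda>r. Z r ** (b r ** h r))" if "continuous_on UNIV h" for h :: "real \<Rightarrow> real^'n^'n"
    by (intro matmul.continuous_on continuous_Z b that)
  have G': "(G h has_vector_derivative Z r ** (b r ** h r)) (at r)"
    and G0: "G h 0 = 0" and Gc: "continuous_on S (G h)"
    if "continuous_on UNIV h" for h :: "real \<Rightarrow> real^'n^'n" and r S
    using has_vector_derivative_primitive[OF cont[OF that]] primitive_0[OF cont[OF that]]
      continuous_on_primitive[OF cont[OF that]] by (simp_all add: G_def)
  have g: "norm (b r ** h r) \<le> (\<epsilon> * M) * exp (- (\<beta> / 2) * r)"
    if "\<And>t. norm (h t) \<le> M * w t" "0 < r" for h :: "real \<Rightarrow> real^'n^'n" and M r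
    using norm_b_mult_le[of r "h r" "M * w r"] that(1)[of r] that(2) by (simp add: w_def mult_ac)
  have L: "(\<lambda>n. (mat 1 - P) ** G h (real n)) \<longlonglongrightarrow> L h"
    if h: "continuous_on UNIV h" "\<And>t. norm (h t) \<le> M * w t" for h :: "real \<Rightarrow> real^'n^'n" and M
  proof -
    have "norm (b r ** h r) \<le> (\<epsilon> * M) * exp (- (\<beta> / 2) * \<bar>r - 0\<bar>)" if "0 < r" for r
      using g[OF h(2) that] that by simp
    then have "convergent (\<lambda>n. (mat 1 - P) ** G h (real n))"
      using unstable_integral_convergent[OF Gc[OF h(1)] G'[OF h(1)]] by blast
    then show ?thesis
      by (simp add: L_def convergent_LIMSEQ_iff)
  qed
  have \<Phi>c: "continuous_on UNIV (\<Phi> h)" if "continuous_on UNIV h" for h :: "real \<Rightarrow> real^'n^'n"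
  proof -
    have "continuous_on UNIV (\<lambda>t. X (max t 0))" "continuous_on UNIV (\<lambda>t. G h (max t 0))"
      by (rule continuous_on_compose2[of UNIV];
          auto intro!: continuous_intros continuous_X Gc[OF that])+
    then show ?thesis
      unfolding \<Phi>_def by (intro matmul.continuous_on continuous_intros)
  qed
  obtain h C where h: "continuous_on UNIV h" "\<And>t. norm (h t) \<le> C * w t" "\<Phi> h = h"
  proof (rule weighted_fixed_point[of w "1/2" \<Phi>])
    fix h :: "real \<Rightarrow> real^'n^'n" and M assume h: "continuous_on UNIV h" "\<And>t. norm (h t) \<le> M * w t"
    have "norm (\<Phi> h t) \<le> (N + 4 * N * (\<epsilon> * M) / \<beta>) * w t" for t
    proof -
      define u where "u = max t 0"
      have u: "0 \<le> u" unfolding u_def by (rule max.cobounded2)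
      have "norm (X u ** P) \<le> N * exp (- \<beta> * u)"
        using stable[of 0 u] u by (simp add: Z0)
      also have "\<dots> \<le> N * w t"
        using N_nonneg \<beta> u by (intro mult_left_mono) (auto simp: w_def u_def)
      finally have "norm (X u ** P) \<le> N * w t" .
      moreover have "norm (X u ** (G h u - L h)) \<le> 4 * N * (\<epsilon> * M) / \<beta> * w t"
        using green_bound(2)[OF Gc[OF h(1)] G0[OF h(1)] G'[OF h(1)] g[OF h(2)] L[OF h] u]
        by (simp add: w_def u_def)
      moreover have "\<Phi> h t = X u ** P + X u ** (G h u - L h)"
        by (simp add: \<Phi>_def u_def matmul_distribs)
      ultimately show ?thesis
        using norm_triangle_ineq[of "X u ** P" "X u ** (G h u - L h)"]
        by (simp only: distrib_right)
    qed
    then show "continuous_on UNIV (\<Phi> h) \<and> (\<exists>M'. \<forall>t. norm (\<Phi> h t) \<le> M' * w t)"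
      using \<Phi>c[OF h(1)] by blast
  next
    fix h k :: "real \<Rightarrow> real^'n^'n" and M M' t :: real
    assume h: "continuous_on UNIV h" "\<And>t. norm (h t) \<le> M' * w t"
      and k: "continuous_on UNIV k" "\<And>t. norm (k t) \<le> M' * w t"
      and hk: "\<And>t. norm (h t - k t) \<le> M * w t"
    have "M \<ge> 0"
      using order_trans[OF norm_ge_zero hk[of 0]] by (simp add: w_def)
    define u where "u = max t 0"
    have u: "0 \<le> u" by (auto simp: u_def)
    have "norm (X u ** ((G h u - G k u) - (L h - L k))) \<le> 4 * N * (\<epsilon> * M) / \<beta> * exp (- (\<beta> / 2) * u)"
    proof (rule green_bound(2)[where g = "\<lambda>r. b r ** (h r - k r)"])
      show "continuous_on {0..} (\<lambda>u. G h u - G k u)"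
        by (intro continuous_intros Gc h k)
      show "((\<lambda>u. G h u - G k u) has_vector_derivative Z r ** (b r ** (h r - k r))) (at r)" for r
        unfolding matmul.diff_right by (intro has_vector_derivative_diff G' h k)
      show "norm (b r ** (h r - k r)) \<le> (\<epsilon> * M) * exp (- (\<beta> / 2) * r)" if "0 < r" for r
        by (rule g[OF hk that])
      show "(\<lambda>n. (mat 1 - P) ** (G h (real n) - G k (real n))) \<longlonglongrightarrow> L h - L k"
        unfolding matmul.diff_right by (intro tendsto_diff L[OF h] L[OF k])
    qed (use u in \<open>auto simp: G0 h k\<close>)
    also have "\<dots> \<le> M / 2 * w t"
      unfolding w_def u_def[symmetric]
      by (intro mult_right_mono contraction_le \<open>M \<ge> 0\<close>) auto
    finally show "norm (\<Phi> h t - \<Phi> k t) \<le> 1/2 * M * w t"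
      by (simp add: \<Phi>_def u_def algebra_simps flip: matmul.diff_right)
  qed (use w in auto)
  \<comment> \<open>\<open>k\<close> agrees with \<open>h\<close> for \<open>t \<ge> 0\<close>, but is differentiable on both sides of 0.\<close>
  define k where "k t = X t ** (P + G h t - L h)" for t
  have k_eq: "k t = h t" if "0 \<le> t" for t
    using fun_cong[OF h(3), of t] that by (simp add: k_def \<Phi>_def)
  have k': "(k has_vector_derivative a t ** k t + b t ** h t) (at t)" for t
  proof -
    have "(k has_vector_derivative X t ** (0 + Z t ** (b t ** h t) - 0)
        + (a t ** X t) ** (P + G h t - L h)) (at t)"
      unfolding k_def
      by (intro matmul.has_vector_derivative X has_vector_derivative_diff has_vector_derivative_add
          has_vector_derivative_const G' h)
    then show ?thesis
      by (simp add: k_def matrix_mul_assoc XZ add.commute)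
  qed
  \<comment> \<open>For t > 0 the function \<open>k\<close> coincides with \<open>h\<close> and so
    solves the perturbed equation; hence V k has derivative zero there, and continuity reaches the
    endpoint 0.\<close>
  have Vk: "V t ** k t = k 0" if "0 \<le> t" for t
  proof -
    have Vk': "((\<lambda>t. V t ** k t) has_vector_derivative
        V t ** (a t ** k t + b t ** h t) + - (V t ** (a t + b t)) ** k t) (at t)" for t
      by (intro matmul.has_vector_derivative V k')
    have "((\<lambda>t. V t ** k t) has_vector_derivative 0) (at t)" if "0 < t" for t
      using Vk'[of t] that by (simp add: k_eq matmul_distribs matrix_mul_assoc)
    moreover have "continuous_on {0..t} (\<lambda>t. V t ** k t)"
      by (rule continuous_on_vector_derivative[OF has_vector_derivative_at_within[OF Vk']])
    ultimately have "V t ** k t = V 0 ** k 0"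
      using eq_of_derivative_zero[OF that, of "\<lambda>t. V t ** k t"] by blast
    then show ?thesis by (simp add: V0)
  qed
  have h_eq: "h t = Y t ** k 0" if "0 \<le> t" for t
    using Vk[OF that] k_eq[OF that] by (simp add: matrix_mul_assoc YV flip: Vk[OF that])
  have "P ** L h = 0"
    using green_bound(1)[OF Gc[OF h(1)] G0[OF h(1)] G'[OF h(1)] g[OF h(2)] L[OF h(1,2)], of 0] by simp
  then have Pk: "P ** k 0 = P"
    by (simp add: k_def X0 G0[OF h(1)] matmul_distribs PP)
  show ?thesis
  proof (rule that[of "k 0 ** P" "C * norm P"])
    show "P ** (k 0 ** P) = P"
      by (simp add: matrix_mul_assoc Pk PP)
    show "(k 0 ** P) ** (k 0 ** P) = k 0 ** P"
      by (metis matrix_mul_assoc Pk PP)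
    fix t :: real assume t: "0 \<le> t"
    have "norm (Y t ** (k 0 ** P)) \<le> norm (h t) * norm P"
      by (simp add: matrix_mul_assoc norm_matrix_matrix_mult_le flip: h_eq[OF t])
    also have "\<dots> \<le> (C * w t) * norm P"
      by (intro mult_right_mono h) auto
    finally show "norm (Y t ** (k 0 ** P)) \<le> C * norm P * exp (- (\<beta> / 2) * t)"
      using t by (simp add: w_def mult_ac)
  qed
qed

end

section \<open>The Green function of the perturbed equation\<close>

context perturbed_dichotomy
begin

text \<open>This is W(r, s), with the jump point \<open>s\<close> as the earlier argument. On the
  diagonal it takes the stable branch.\<close>

definition green :: "real^'n^'n \<Rightarrow> real \<Rightarrow> real \<Rightarrow> real^'n^'n" where
  "green Q s r = (if r < s then - (Y r ** (mat 1 - Q) ** V s) else Y r ** Q ** V s)"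

text \<open>Variation of constants: multiplication by \<open>Z\<close> cancels the unperturbed
  coefficient and leaves only the perturbation.\<close>

lemma ZU_deriv:
  assumes "(U has_vector_derivative (a r + b r) ** U r) (at r)"
  shows "((\<lambda>r. Z r ** U r) has_vector_derivative Z r ** (b r ** U r)) (at r)"
  using matmul.has_vector_derivative[OF Z assms]
  by (simp add: matmul_distribs matrix_mul_assoc)

lemma Y_mult_deriv: "((\<lambda>r. Y r ** A) has_vector_derivative (a r + b r) ** (Y r ** A)) (at r)"
  using matmul.has_vector_derivative[OF Y has_vector_derivative_const[of A]]
  by (simp add: matrix_mul_assoc)

text \<open>One pass of a given bound through W = G + \<integral> G b W. The summand
  \<open>N\<close> comes from the unperturbed Green function, and the stable and unstable integrals
  with g = b W contribute 2 N \<epsilon> M / \<beta> each.\<close>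

lemma green_step:
  assumes PQ: "P ** Q = P" and s: "0 \<le> s" and t: "0 \<le> t"
    and M: "\<And>r. 0 \<le> r \<Longrightarrow> norm (green Q s r) \<le> M * exp (- (\<beta> / 2) * \<bar>r - s\<bar>)"
  shows "norm (green Q s t) \<le> (N + 4 * N * (\<epsilon> * M) / \<beta>) * exp (- (\<beta> / 2) * \<bar>t - s\<bar>)"
proof -
  define W where "W = green Q s"
  \<comment> \<open>\<open>D\<close> cancels the jump of \<open>Z W\<close> at \<open>s\<close>, so that \<open>F\<close> is a continuous primitive of \<open>Z b W\<close>.\<close>
  define D where "D r = Z r ** (Y r ** V s) - Z s" for r
  define F where "F r = Z r ** (Y r ** (Q ** V s)) - D (min r s)" for r
  define e where "e = exp (- (\<beta> / 2) * \<bar>t - s\<bar>)"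
  define K where "K = 2 * N * (\<epsilon> * M) / \<beta> * e"
  have W_le: "norm (W r) \<le> M * exp (- (\<beta> / 2) * \<bar>r - s\<bar>)" if "0 \<le> r" for r
    using M[OF that] by (simp add: W_def)
  have "M \<ge> 0"
    using order_trans[OF norm_ge_zero M[OF s]] by simp
  have Ds: "D s = 0"
    by (simp add: D_def YV)
  have D': "(D has_vector_derivative Z r ** (b r ** (Y r ** V s))) (at r)" for r
    unfolding D_def has_vector_derivative_diff_const by (rule ZU_deriv[OF Y_mult_deriv])
  have E': "((\<lambda>r. Z r ** (Y r ** (Q ** V s))) has_vector_derivative
      Z r ** (b r ** (Y r ** (Q ** V s)))) (at r)" for r
    by (rule ZU_deriv[OF Y_mult_deriv])
  have Fc: "continuous_on {0..} F"
  proof -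
    have "continuous_on UNIV D"
      by (rule continuous_on_vector_derivative[OF has_vector_derivative_at_within[OF D']])
    then have "continuous_on {0..} (\<lambda>r. D (min r s))"
      by (rule continuous_on_compose2) (auto intro!: continuous_intros)
    moreover have "continuous_on {0..} (\<lambda>r. Z r ** (Y r ** (Q ** V s)))"
      by (rule continuous_on_vector_derivative[OF has_vector_derivative_at_within[OF E']])
    ultimately show ?thesis
      unfolding F_def by (intro continuous_on_diff)
  qed
  have F': "(F has_vector_derivative Z r ** (b r ** W r)) (at r)" if "r \<noteq> s" for r
  proof (cases "r < s")
    case True
    have "((\<lambda>r. Z r ** (Y r ** (Q ** V s)) - D r) has_vector_derivative
        Z r ** (b r ** (Y r ** (Q ** V s))) - Z r ** (b r ** (Y r ** V s))) (at r)"
      by (intro has_vector_derivative_diff E' D')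
    then have "(F has_vector_derivative
        Z r ** (b r ** (Y r ** (Q ** V s))) - Z r ** (b r ** (Y r ** V s))) (at r)"
      by (rule has_vector_derivative_transform_within_open[of _ _ _ "{..<s}"])
        (use True in \<open>auto simp: F_def\<close>)
    then show ?thesis
      using True by (simp add: W_def green_def matmul_distribs matrix_mul_assoc)
  next
    case False
    then have "r \<in> {s<..}" using that by simp
    moreover have "Z y ** (Y y ** (Q ** V s)) = F y" if "y \<in> {s<..}" for y
      using that by (simp add: F_def Ds)
    ultimately have "(F has_vector_derivative Z r ** (b r ** (Y r ** (Q ** V s)))) (at r)"
      using has_vector_derivative_transform_within_open[OF E' open_greaterThan] by blast
    then show ?thesis
      using False by (simp add: W_def green_def matrix_mul_assoc)
  qed
  have g: "norm (b r ** W r) \<le> (\<epsilon> * M) * exp (- (\<beta> / 2) * \<bar>r - s\<bar>)" if "0 < r" for r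
    using norm_b_mult_le[OF _ W_le] that by (simp add: mult.assoc)
  \<comment> \<open>Here \<open>P ** Q = P\<close> enters: the terms containing \<open>V s\<close>
    cancel under \<open>P\<close>, so that the homogeneous term below is the unperturbed Green
    function \<open>G\<close>.\<close>
  have PF0: "P ** F 0 = P ** Z s"
    using s by (simp add: F_def D_def Z0 Y0 matmul_distribs matrix_mul_assoc PQ)
  have FT: "F r = Z r ** W r" if "s \<le> r" for r
    using that by (simp add: F_def W_def green_def Ds matrix_mul_assoc)
  have Ft: "F r = Z r ** W r + Z s" if "r < s" for r
    using that by (simp add: F_def D_def W_def green_def matmul_distribs matrix_mul_assoc)
  define G where "G = (if t < s then - (X t ** (mat 1 - P) ** Z s) else X t ** P ** Z s)"
  \<comment> \<open>The integral equation truncated at \<open>T\<close>; the last summand is a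
    remainder that vanishes as \<open>T\<close> tends to infinity.\<close>
  have split: "W t = G + X t ** P ** (F t - F 0) - X t ** (mat 1 - P) ** (F T - F t)
      + X t ** (mat 1 - P) ** F T" for T
  proof -
    have "W t = X t ** (Z t ** W t)"
      by (simp add: matrix_mul_assoc XZ)
    moreover have "X t ** P ** F 0 = X t ** P ** Z s"
      by (simp add: PF0 flip: matrix_mul_assoc)
    ultimately show ?thesis
      using FT[of t] Ft[of t]
      by (cases "t < s") (auto simp: G_def matmul_distribs)
  qed
  have "norm G \<le> N * exp (- \<beta> * \<bar>t - s\<bar>)"
    using stable[OF s, of t] unstable[OF t, of s] by (auto simp: G_def abs_if)
  also have "\<dots> \<le> N * e"
    using N_nonneg \<beta> unfolding e_def by (intro mult_left_mono) auto
  finally have nG: "norm G \<le> N * e" .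
  \<comment> \<open>Beyond \<open>s\<close> one has \<open>F T = Z T ** W T\<close>, so boundedness
    of \<open>W\<close> and the unstable estimate from \<open>t\<close> to \<open>T\<close> force
    exponential decay of the remainder.\<close>
  have "norm (W t) \<le> (N * e + K + K) + N * M * exp (- \<beta> * (T - t))" if "max s t \<le> T" for T
  proof -
    have T: "s \<le> T" "t \<le> T" using that by auto
    have "norm (X t ** (mat 1 - P) ** F T) \<le> norm (X t ** (mat 1 - P) ** Z T) * norm (W T)"
      using norm_matrix_matrix_mult_le[of "X t ** (mat 1 - P) ** Z T" "W T"]
      by (simp add: FT T matrix_mul_assoc)
    also have "\<dots> \<le> (N * exp (- \<beta> * (T - t))) * M"
    proof (rule mult_mono)
      have "M * exp (- (\<beta> / 2) * \<bar>T - s\<bar>) \<le> M * 1"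
        using \<beta> \<open>M \<ge> 0\<close> by (intro mult_left_mono) auto
      then show "norm (W T) \<le> M"
        using W_le[of T] T s by simp
    qed (use unstable[OF t T(2)] N_nonneg in auto)
    finally have "norm (X t ** (mat 1 - P) ** F T) \<le> N * M * exp (- \<beta> * (T - t))"
      by (simp add: mult_ac)
    moreover have "norm (X t ** P ** (F t - F 0)) \<le> K"
      unfolding K_def e_def by (rule stable_integral_bound[OF Fc F' g t])
    moreover have "norm (X t ** (mat 1 - P) ** (F T - F t)) \<le> K"
      unfolding K_def e_def by (rule unstable_integral_bound[OF Fc F' g t T(2)])
    ultimately show ?thesis
      unfolding split[of T]
      using nG norm_triangle_ineq[of "G + X t ** P ** (F t - F 0) - X t ** (mat 1 - P) ** (F T - F t)"
          "X t ** (mat 1 - P) ** F T"]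
        norm_triangle_ineq4[of "G + X t ** P ** (F t - F 0)" "X t ** (mat 1 - P) ** (F T - F t)"]
        norm_triangle_ineq[of G "X t ** P ** (F t - F 0)"]
      by linarith
  qed
  then have ev: "\<forall>\<^sub>F T in at_top. norm (W t) \<le> (N * e + K + K) + N * M * exp (- \<beta> * (T - t))"
    by (auto simp: eventually_at_top_linorder intro!: exI[of _ "max s t"])
  have lim: "((\<lambda>T. (N * e + K + K) + N * M * exp (- \<beta> * (T - t))) \<longlongrightarrow> (N * e + K + K) + N * M * 0) at_top"
  proof (intro tendsto_intros filterlim_compose[OF exp_at_bot])
    have "filterlim (\<lambda>T. - t + T) at_top at_top"
      by (rule filterlim_tendsto_add_at_top[OF tendsto_const filterlim_ident])
    then show "filterlim (\<lambda>T. - \<beta> * (T - t)) at_bot at_top"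
      using \<beta> by (intro filterlim_tendsto_neg_mult_at_bot[OF tendsto_const]) auto
  qed
  have "norm (W t) \<le> (N * e + K + K) + N * M * 0"
    by (rule tendsto_lowerbound[OF lim ev]) simp
  also have "\<dots> = (N + 4 * N * (\<epsilon> * M) / \<beta>) * e"
    by (simp add: K_def distrib_right)
  finally show ?thesis
    by (simp add: W_def e_def)
qed

text \<open>The bound may depend on \<open>s\<close>: compactness of [0, s] handles the unstable
  branch, and the decay of \<open>Y t ** Q\<close> handles the stable one.\<close>

lemma green_bounded:
  assumes C: "\<And>t. 0 \<le> t \<Longrightarrow> norm (Y t ** Q) \<le> C * exp (- (\<beta> / 2) * t)" and s: "0 \<le> s"
  shows "bdd_above ((\<lambda>r. norm (green Q s r) * exp ((\<beta> / 2) * \<bar>r - s\<bar>)) ` {0..})"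
proof -
  have "compact ((\<lambda>r. norm (Y r ** (mat 1 - Q) ** V s) * exp ((\<beta> / 2) * \<bar>r - s\<bar>)) ` {0..s})"
    by (intro compact_continuous_image continuous_intros matmul.continuous_on continuous_Y) auto
  then obtain B where B: "\<And>r. r \<in> {0..s} \<Longrightarrow>
      norm (Y r ** (mat 1 - Q) ** V s) * exp ((\<beta> / 2) * \<bar>r - s\<bar>) \<le> B"
    using bounded_imp_bdd_above[OF compact_imp_bounded] by (force elim: bdd_above.E)
  have "norm (green Q s r) * exp ((\<beta> / 2) * \<bar>r - s\<bar>) \<le> max B (C * norm (V s))" if r: "0 \<le> r" for r
  proof (cases "r < s")
    case True
    then show ?thesis
      using B[of r] r by (simp add: green_def)
  next
    case False
    have "norm (green Q s r) * exp ((\<beta> / 2) * \<bar>r - s\<bar>)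
        \<le> (C * exp (- (\<beta> / 2) * r) * norm (V s)) * exp ((\<beta> / 2) * r)"
    proof (rule mult_mono)
      have "norm (Y r ** Q ** V s) \<le> norm (Y r ** Q) * norm (V s)"
        by (rule norm_matrix_matrix_mult_le)
      also have "\<dots> \<le> C * exp (- (\<beta> / 2) * r) * norm (V s)"
        by (intro mult_right_mono C r) auto
      finally show le: "norm (green Q s r) \<le> C * exp (- (\<beta> / 2) * r) * norm (V s)"
        using False by (simp add: green_def)
      show "0 \<le> C * exp (- (\<beta> / 2) * r) * norm (V s)"
        using order_trans[OF norm_ge_zero le] .
      show "exp ((\<beta> / 2) * \<bar>r - s\<bar>) \<le> exp ((\<beta> / 2) * r)"
        using False s \<beta> by simp
    qed simp
    also have "\<dots> = C * norm (V s) * (exp (- (\<beta> / 2) * r) * exp ((\<beta> / 2) * r))"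
      by (simp only: mult_ac)
    also have "\<dots> = C * norm (V s)"
      by (simp flip: exp_add)
    finally show ?thesis by simp
  qed
  then show ?thesis
    by (intro bdd_aboveI2[where M = "max B (C * norm (V s))"]) auto
qed

text \<open>With \<open>M\<close> the best constant for this \<open>s\<close>,
  \<open>green_step\<close> bounds \<open>M\<close> by N + M / 2. Its finiteness, from
  \<open>green_bounded\<close>, allows M / 2 to be absorbed, and \<open>C\<close> disappears from
  the result.\<close>

lemma green_estimate:
  assumes PQ: "P ** Q = P"
    and C: "\<And>t. 0 \<le> t \<Longrightarrow> norm (Y t ** Q) \<le> C * exp (- (\<beta> / 2) * t)"
    and s: "0 \<le> s" and t: "0 \<le> t"
  shows "norm (green Q s t) \<le> 2 * N * exp (- (\<beta> / 2) * \<bar>t - s\<bar>)"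
proof -
  define M where "M = (SUP r\<in>{0..}. norm (green Q s r) * exp ((\<beta> / 2) * \<bar>r - s\<bar>))"
  have shift: "norm A \<le> L * exp (- (\<beta> / 2) * x) \<longleftrightarrow> norm A * exp ((\<beta> / 2) * x) \<le> L"
    for A :: "real^'n^'n" and L x
    by (simp add: exp_minus pos_le_divide_eq flip: divide_inverse)
  have le: "norm (green Q s r) \<le> M * exp (- (\<beta> / 2) * \<bar>r - s\<bar>)" if "0 \<le> r" for r
    unfolding shift M_def by (rule cSUP_upper[OF _ green_bounded[OF C s]]) (use that in auto)
  have "M \<ge> 0"
    using order_trans[OF norm_ge_zero le[OF s]] by simp
  have "M \<le> N + 4 * N * (\<epsilon> * M) / \<beta>"
    unfolding M_def
    by (rule cSUP_least) (use green_step[OF PQ s _ le] in \<open>auto simp only: shift M_def atLeast_iff\<close>)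
  also have "\<dots> \<le> N + M / 2"
    using contraction_le[OF \<open>M \<ge> 0\<close>] by simp
  finally have "M \<le> 2 * N" by simp
  then have "M * exp (- (\<beta> / 2) * \<bar>t - s\<bar>) \<le> 2 * N * exp (- (\<beta> / 2) * \<bar>t - s\<bar>)"
    by (intro mult_right_mono) auto
  with le[OF t] show ?thesis by linarith
qed

lemma roughness:
  obtains Q where "Q ** Q = Q"
    "\<And>s t. 0 \<le> s \<Longrightarrow> s \<le> t \<Longrightarrow> norm (Y t ** Q ** V s) \<le> 2 * N * exp (- (\<beta> / 2) * (t - s))"
    "\<And>s t. 0 \<le> t \<Longrightarrow> t \<le> s \<Longrightarrow> norm (Y t ** (mat 1 - Q) ** V s)
      \<le> (norm (mat 1 :: real^'n^'n) + 2 * N) * exp (- (\<beta> / 2) * (s - t))"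
proof -
  obtain Q C where Q: "P ** Q = P" "Q ** Q = Q"
    and C: "\<And>t. 0 \<le> t \<Longrightarrow> norm (Y t ** Q) \<le> C * exp (- (\<beta> / 2) * t)"
    using decaying_projection by blast
  note est = green_estimate[OF Q(1) C]
  have 1: "norm (Y t ** Q ** V s) \<le> 2 * N * exp (- (\<beta> / 2) * (t - s))" if "0 \<le> s" "s \<le> t" for s t
    using est[of s t] that by (simp add: green_def)
  have 2: "norm (Y t ** (mat 1 - Q) ** V s)
      \<le> (norm (mat 1 :: real^'n^'n) + 2 * N) * exp (- (\<beta> / 2) * (s - t))" if "0 \<le> t" "t \<le> s" for s t
  proof (cases "t = s")
    case True
    \<comment> \<open>On the diagonal \<open>green\<close> is the stable branch, so the
      complementary term is bounded through its difference from the identity; this is the source of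
      the extra \<open>norm (mat 1)\<close>.\<close>
    have "norm (Y t ** (mat 1 - Q) ** V s) = norm (mat 1 - Y s ** Q ** V s)"
      by (simp add: True matmul_distribs YV)
    also have "\<dots> \<le> norm (mat 1 :: real^'n^'n) + norm (Y s ** Q ** V s)"
      by (rule norm_triangle_ineq4)
    finally show ?thesis
      using 1[of s s] that True by simp
  next
    case False
    have "norm (Y t ** (mat 1 - Q) ** V s) \<le> 2 * N * exp (- (\<beta> / 2) * (s - t))"
      using est[of s t] that False by (simp add: green_def)
    also have "\<dots> \<le> (norm (mat 1 :: real^'n^'n) + 2 * N) * exp (- (\<beta> / 2) * (s - t))"
      by (intro mult_right_mono) auto
    finally show ?thesis .
  qed
  show ?thesis by (rule that[OF Q(2) 1 2])
qed

end

subsection \<open>Change of time\<close>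

text \<open>Off \<open>c\<close> the functions \<open>u\<close> and \<open>primitive d\<close> have
  the same derivative, so their difference, being continuous, is constant across \<open>c\<close>.
  This serves the origin, which the chain rule for the change of time leaves out.\<close>

lemma has_vector_derivative_removable:
  fixes u d :: "real \<Rightarrow> 'a::euclidean_space"
  assumes u: "continuous_on UNIV u" and d: "continuous_on UNIV d"
    and u': "\<And>x. x \<noteq> c \<Longrightarrow> (u has_vector_derivative d x) (at x)"
  shows "(u has_vector_derivative d x) (at x)"
proof -
  define v where "v x = u x - primitive d x" for x
  have v: "continuous_on S v" for S
    unfolding v_def by (intro continuous_intros continuous_on_subset[OF u] continuous_on_primitive d) simp
  have v': "(v has_vector_derivative 0) (at x)" if "x \<noteq> c" for x
    using has_vector_derivative_diff[OF u'[OF that] has_vector_derivative_primitive[OF d, of x]]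
    by (simp add: v_def[abs_def])
  have "v y = v x" if "x \<le> y" for x y
    using norm_diff_le_of_derivative_le_except[where \<phi> = "\<lambda>_. 0" and \<phi>' = "\<lambda>_. 0",
        OF that v _ v'] by simp
  then have "v x = v 0" for x
    by (metis linear)
  then have "u = (\<lambda>x. primitive d x + v 0)"
    by (simp add: v_def fun_eq_iff algebra_simps)
  then show ?thesis
    using has_vector_derivative_add[OF has_vector_derivative_primitive[OF d, of x]
        has_vector_derivative_const[of "v 0"]] by simp
qed

lemma has_vector_derivative_0_iff_quotient:
  "(u has_vector_derivative D) (at 0) \<longleftrightarrow> ((\<lambda>e. (u e - u 0) /\<^sub>R e) \<longlongrightarrow> D) (at 0)"
proof -
  have "(u has_vector_derivative D) (at 0) \<longleftrightarrow> ((\<lambda>e. norm (u e - u 0 - e *\<^sub>R D) / norm e) \<longlongrightarrow> 0) (at 0)"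
    by (simp add: has_vector_derivative_def has_derivative_at bounded_linear_scaleR_left)
  also have "\<dots> \<longleftrightarrow> ((\<lambda>e. norm ((u e - u 0) /\<^sub>R e - D)) \<longlongrightarrow> 0) (at 0)"
  proof (rule tendsto_cong)
    have "norm (u e - u 0 - e *\<^sub>R D) / norm e = norm ((u e - u 0) /\<^sub>R e - D)" if "e \<noteq> 0" for e
    proof -
      have "(u e - u 0) /\<^sub>R e - D = (u e - u 0 - e *\<^sub>R D) /\<^sub>R e"
        using that by (simp add: scaleR_diff_right)
      then show ?thesis by (simp add: divide_inverse mult.commute)
    qed
    then show "\<forall>\<^sub>F e in at 0. norm (u e - u 0 - e *\<^sub>R D) / norm e = norm ((u e - u 0) /\<^sub>R e - D)"
      by (auto simp: eventually_at_filter)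
  qed
  also have "\<dots> \<longleftrightarrow> ((\<lambda>e. (u e - u 0) /\<^sub>R e) \<longlongrightarrow> D) (at 0)"
    by (simp add: tendsto_norm_zero_iff LIM_zero_iff)
  finally show ?thesis .
qed

text \<open>The quotient is that of e \<mapsto> g (t + e k) at 0 with k > 0; the chain rule for this
  affine map and for its inverse gives the two directions.\<close>

lemma has_conf_deriv_nz_iff:
  assumes "t \<noteq> 0"
  shows "has_conf_deriv_nz \<alpha> g D t \<longleftrightarrow> (g has_vector_derivative (\<bar>t\<bar> powr (\<alpha> - 1)) *\<^sub>R D) (at t)"
proof -
  define k where "k = \<bar>t\<bar> powr (1 - \<alpha>)"
  define u where "u e = g (t + e * k)" for e
  have k: "k > 0" "\<bar>t\<bar> powr (\<alpha> - 1) = 1 / k"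
    using assms powr_minus_divide[of "\<bar>t\<bar>" "1 - \<alpha>"] by (simp_all add: k_def)
  have "has_conf_deriv_nz \<alpha> g D t \<longleftrightarrow> (u has_vector_derivative D) (at 0)"
    by (simp add: has_conf_deriv_nz_def has_vector_derivative_0_iff_quotient u_def k_def)
  also have "\<dots> \<longleftrightarrow> (g has_vector_derivative (1 / k) *\<^sub>R D) (at t)"
  proof
    assume u: "(u has_vector_derivative D) (at 0)"
    have "((\<lambda>x. (x - t) / k) has_vector_derivative 1 / k) (at t)"
      using k(1) by (auto intro!: derivative_eq_intros simp flip: has_real_derivative_iff_has_vector_derivative)
    from vector_diff_chain_at[OF this, of u D] u
    show "(g has_vector_derivative (1 / k) *\<^sub>R D) (at t)"
      using k by (simp add: o_def u_def)
  next
    assume g: "(g has_vector_derivative (1 / k) *\<^sub>R D) (at t)"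
    have "((\<lambda>e. t + e * k) has_vector_derivative k) (at 0)"
      by (auto intro!: derivative_eq_intros simp flip: has_real_derivative_iff_has_vector_derivative)
    from vector_diff_chain_at[OF this, of g "(1 / k) *\<^sub>R D"] g
    show "(u has_vector_derivative D) (at 0)"
      using k by (simp add: o_def u_def[abs_def])
  qed
  finally show ?thesis by (simp add: k)
qed

text \<open>The odd extension of the power function, which for p > 0 makes the change of time a
  bijection of the whole line fixing 0.\<close>

definition odd_powr :: "real \<Rightarrow> real \<Rightarrow> real" where
  "odd_powr p x = sgn x * \<bar>x\<bar> powr p"

lemma odd_powr_nonneg: "0 \<le> x \<Longrightarrow> odd_powr p x = x powr p"
  by (simp add: odd_powr_def sgn_if)

lemma abs_odd_powr: "\<bar>odd_powr p x\<bar> = \<bar>x\<bar> powr p"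
  by (simp add: odd_powr_def abs_mult sgn_if)

lemma odd_powr_inverse:
  assumes "p * q = 1"
  shows "odd_powr p (odd_powr q x) = x"
proof -
  have "sgn (odd_powr q x) = sgn x"
    by (auto simp: odd_powr_def sgn_mult sgn_if)
  moreover have "\<bar>odd_powr q x\<bar> powr p = \<bar>x\<bar>"
    using assms by (simp add: abs_odd_powr powr_powr mult.commute)
  ultimately have "odd_powr p (odd_powr q x) = sgn x * \<bar>x\<bar>"
    by (simp only: odd_powr_def)
  then show ?thesis
    by (simp only: sgn_mult_abs)
qed

lemma continuous_odd_powr:
  assumes "p > 0"
  shows "continuous_on S (odd_powr p)"
proof -
  have "odd_powr p = (\<lambda>x. max x 0 powr p - max (- x) 0 powr p)"
    by (auto simp: odd_powr_def fun_eq_iff sgn_if)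
  moreover have "continuous_on S (\<lambda>x. max x 0 powr p - max (- x) 0 powr p)"
    using assms by (intro continuous_intros continuous_on_powr') auto
  ultimately show ?thesis by simp
qed

lemma odd_powr_has_real_derivative:
  assumes "x \<noteq> 0"
  shows "(odd_powr p has_real_derivative p * \<bar>x\<bar> powr (p - 1)) (at x)"
proof (cases "x > 0")
  case True
  have "((\<lambda>x. x powr p) has_real_derivative p * \<bar>x\<bar> powr (p - 1)) (at x)"
    using True has_real_derivative_powr[OF True, of p] by simp
  then show ?thesis
    by (rule has_field_derivative_transform_within_open[where S = "{0<..}"])
      (use True in \<open>auto simp: odd_powr_def\<close>)
next
  case False
  then have x: "- x > 0" using assms by simp
  have "((\<lambda>x. - ((- x) powr p)) has_real_derivative p * \<bar>x\<bar> powr (p - 1)) (at x)"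
    using x by (auto intro!: derivative_eq_intros)
  then show ?thesis
    by (rule has_field_derivative_transform_within_open[where S = "{..<0}"])
      (use x in \<open>auto simp: odd_powr_def\<close>)
qed

text \<open>Its derivative away from 0 is \<open>\<bar>t\<bar> powr (\<alpha> - 1)\<close>, so the
  conformable derivative becomes the ordinary one in the new variable.\<close>

definition conf_time :: "real \<Rightarrow> real \<Rightarrow> real" where
  "conf_time \<alpha> t = odd_powr \<alpha> t / \<alpha>"

definition conf_time_inv :: "real \<Rightarrow> real \<Rightarrow> real" where
  "conf_time_inv \<alpha> \<tau> = odd_powr (1 / \<alpha>) (\<alpha> * \<tau>)"

lemma E_conf_eq: "0 \<le> t \<Longrightarrow> E_conf \<alpha> l t = exp (l * conf_time \<alpha> t)"
  by (simp add: E_conf_def conf_time_def odd_powr_nonneg)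

context
  fixes \<alpha> :: real
  assumes \<alpha>: "\<alpha> > 0"
begin

lemma conf_time_inverse: "conf_time \<alpha> (conf_time_inv \<alpha> \<tau>) = \<tau>"
    "conf_time_inv \<alpha> (conf_time \<alpha> t) = t"
  using \<alpha> by (simp_all add: conf_time_def conf_time_inv_def odd_powr_inverse)

lemma conf_time_0: "conf_time \<alpha> 0 = 0" "conf_time_inv \<alpha> 0 = 0"
  by (simp_all add: conf_time_def conf_time_inv_def odd_powr_def)

lemma conf_time_mono: "0 \<le> s \<Longrightarrow> s \<le> t \<Longrightarrow> conf_time \<alpha> s \<le> conf_time \<alpha> t"
  using \<alpha> by (simp add: conf_time_def odd_powr_nonneg divide_right_mono powr_mono2)

lemma conf_time_inv_mono: "0 \<le> s \<Longrightarrow> s \<le> t \<Longrightarrow> conf_time_inv \<alpha> s \<le> conf_time_inv \<alpha> t"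
  using \<alpha> by (simp add: conf_time_inv_def odd_powr_nonneg powr_mono2)

lemma continuous_conf_time: "continuous_on S (conf_time \<alpha>)"
    "continuous_on S (conf_time_inv \<alpha>)"
proof -
  show "continuous_on S (conf_time \<alpha>)"
    unfolding conf_time_def using \<alpha> by (intro continuous_intros continuous_odd_powr) auto
  show "continuous_on S (conf_time_inv \<alpha>)"
    unfolding conf_time_inv_def
    by (rule continuous_on_compose2[OF continuous_odd_powr[of _ UNIV]])
      (use \<alpha> in \<open>auto intro!: continuous_intros\<close>)
qed

lemma conf_time_deriv:
  assumes "t \<noteq> 0"
  shows "(conf_time \<alpha> has_vector_derivative \<bar>t\<bar> powr (\<alpha> - 1)) (at t)"
  using DERIV_cdivide[OF odd_powr_has_real_derivative[OF assms, of \<alpha>], of \<alpha>] \<alpha>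
  by (simp add: conf_time_def[abs_def] has_real_derivative_iff_has_vector_derivative)

lemma conf_time_inv_deriv:
  assumes "\<tau> \<noteq> 0"
  shows "(conf_time_inv \<alpha> has_vector_derivative \<bar>conf_time_inv \<alpha> \<tau>\<bar> powr (1 - \<alpha>)) (at \<tau>)"
proof -
  have "\<alpha> * \<tau> \<noteq> 0" using assms \<alpha> by simp
  from DERIV_chain2[OF odd_powr_has_real_derivative[OF this, of "1 / \<alpha>"] DERIV_cmult_Id]
  have "(conf_time_inv \<alpha> has_real_derivative \<bar>\<alpha> * \<tau>\<bar> powr (1 / \<alpha> - 1)) (at \<tau>)"
    using \<alpha> by (simp add: conf_time_inv_def[abs_def])
  moreover have "\<bar>conf_time_inv \<alpha> \<tau>\<bar> powr (1 - \<alpha>) = \<bar>\<alpha> * \<tau>\<bar> powr (1 / \<alpha> - 1)"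
    using \<alpha> by (simp add: conf_time_inv_def abs_odd_powr powr_powr right_diff_distrib)
  ultimately show ?thesis
    by (simp add: has_real_derivative_iff_has_vector_derivative)
qed

lemma conf_deriv_imp_has_vector_derivative:
  assumes g: "has_conf_deriv \<alpha> g D (conf_time_inv \<alpha> \<tau>)" and \<tau>: "\<tau> \<noteq> 0"
  shows "((\<lambda>\<tau>. g (conf_time_inv \<alpha> \<tau>)) has_vector_derivative D) (at \<tau>)"
proof -
  define t where "t = conf_time_inv \<alpha> \<tau>"
  have t: "t \<noteq> 0"
    using \<tau> conf_time_inverse(1)[of \<tau>] conf_time_0 by (auto simp: t_def)
  then have "(g has_vector_derivative \<bar>t\<bar> powr (\<alpha> - 1) *\<^sub>R D) (at t)"
    using g by (simp add: has_conf_deriv_def has_conf_deriv_nz_iff t_def)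
  from vector_diff_chain_at[OF conf_time_inv_deriv[OF \<tau>] this[unfolded t_def]]
  have "(g \<circ> conf_time_inv \<alpha> has_vector_derivative (\<bar>t\<bar> powr (1 - \<alpha>) * \<bar>t\<bar> powr (\<alpha> - 1)) *\<^sub>R D) (at \<tau>)"
    by (simp add: t_def)
  moreover have "\<bar>t\<bar> powr (1 - \<alpha>) * \<bar>t\<bar> powr (\<alpha> - 1) = 1"
    using t by (simp flip: powr_add)
  ultimately show ?thesis
    by (simp add: o_def)
qed

lemma has_conf_deriv_compose:
  assumes f: "\<And>\<tau>. (f has_vector_derivative d \<tau>) (at \<tau>)"
    and d: "continuous_on UNIV d"
  shows "has_conf_deriv \<alpha> (\<lambda>t. f (conf_time \<alpha> t)) (d (conf_time \<alpha> t)) t"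
proof -
  have nz: "has_conf_deriv_nz \<alpha> (\<lambda>t. f (conf_time \<alpha> t)) (d (conf_time \<alpha> t)) t" if "t \<noteq> 0" for t
    unfolding has_conf_deriv_nz_iff[OF that]
    using vector_diff_chain_at[OF conf_time_deriv[OF that] f] by (simp add: o_def)
  show ?thesis
  proof (cases "t = 0")
    case True
    \<comment> \<open>At 0 the definition asks for a limit of nearby values. The witness for
      \<open>h\<close> is \<open>\<lambda>t. d (conf_time \<alpha> t)\<close>, and its continuity
      supplies the limit.\<close>
    have "continuous_on UNIV (\<lambda>t. d (conf_time \<alpha> t))"
      by (rule continuous_on_compose2[OF d continuous_conf_time(1)]) simp
    then have "((\<lambda>t. d (conf_time \<alpha> t)) \<longlongrightarrow> d (conf_time \<alpha> 0)) (at 0)"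
      by (simp add: continuous_on_def)
    moreover have "\<forall>\<^sub>F s in at 0. has_conf_deriv_nz \<alpha> (\<lambda>t. f (conf_time \<alpha> t)) (d (conf_time \<alpha> s)) s"
      using nz by (auto simp: eventually_at_filter)
    ultimately show ?thesis
      using True by (auto simp: has_conf_deriv_def)
  qed (simp add: has_conf_deriv_def nz)
qed

end

section \<open>Matrix functions and their columns\<close>

lemma column_matrix_mult: "column j (A ** B) = A *v column j B"
  by (simp add: vec_eq_iff column_def matrix_matrix_mult_def matrix_vector_mult_def)

lemma bounded_linear_column: "bounded_linear (column j :: real^'n^'m \<Rightarrow> real^'m)"
  by (intro linear_conv_bounded_linear[THEN iffD1] linearI) (auto simp: column_def vec_eq_iff)

text \<open>Embeds a vector as the column \<open>j\<close>. Summing these embeddings rebuilds a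
  matrix by bounded linear maps, so columnwise continuity and derivatives pass to the
  matrix.\<close>

definition column_matrix :: "'n \<Rightarrow> real^'m \<Rightarrow> real^'n^'m" where
  "column_matrix j v = (\<chi> i k. if k = j then v $ i else 0)"

lemma bounded_linear_column_matrix: "bounded_linear (column_matrix j)"
  by (intro linear_conv_bounded_linear[THEN iffD1] linearI)
    (auto simp: column_matrix_def vec_eq_iff)

lemma sum_column_matrix: "(\<Sum>j\<in>UNIV. column_matrix j (column j M)) = M"
  by (simp add: column_matrix_def column_def vec_eq_iff)

lemma has_vector_derivative_columns:
  fixes X :: "real \<Rightarrow> real^'n^'m"
  assumes "\<And>j. ((\<lambda>t. column j (X t)) has_vector_derivative column j D) (at t)"
  shows "(X has_vector_derivative D) (at t)"
proof -
  have "((\<lambda>t. \<Sum>j\<in>UNIV. column_matrix j (column j (X t))) has_vector_derivative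
      (\<Sum>j\<in>UNIV. column_matrix j (column j D))) (at t)"
    by (intro has_vector_derivative_sum
        bounded_linear.has_vector_derivative[OF bounded_linear_column_matrix] assms)
  then show ?thesis by (simp add: sum_column_matrix)
qed

lemma continuous_on_columns:
  fixes X :: "'a::topological_space \<Rightarrow> real^'n^'m"
  assumes "\<And>j. continuous_on S (\<lambda>t. column j (X t))"
  shows "continuous_on S X"
proof -
  have "continuous_on S (\<lambda>t. \<Sum>j\<in>UNIV. column_matrix j (column j (X t)))"
    by (intro continuous_on_sum bounded_linear.continuous_on[OF bounded_linear_column_matrix] assms)
  then show ?thesis by (simp add: sum_column_matrix)
qed

text \<open>For \<tau> \<noteq> 0 this is the chain rule applied to columns; at 0 it follows because
  the function and the right-hand side are continuous.\<close>

lemma fundamental_matrix_rescaled: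
  assumes \<alpha>: "\<alpha> > 0" and A: "continuous_on UNIV A" and X: "fundamental_matrix \<alpha> A X"
  shows "((\<lambda>\<tau>. X (conf_time_inv \<alpha> \<tau>)) has_vector_derivative
    A (conf_time_inv \<alpha> \<tau>) ** X (conf_time_inv \<alpha> \<tau>)) (at \<tau>)"
proof (rule has_vector_derivative_removable[where c = 0])
  have sol: "conf_solution \<alpha> A (\<lambda>t. column j (X t))" for j
    using X by (simp add: fundamental_matrix_def)
  have "continuous_on UNIV X"
    by (rule continuous_on_columns) (use sol in \<open>simp add: conf_solution_def\<close>)
  then show Xc: "continuous_on UNIV (\<lambda>\<tau>. X (conf_time_inv \<alpha> \<tau>))"
    by (rule continuous_on_compose2[OF _ continuous_conf_time(2)[OF \<alpha>]]) simp
  have "continuous_on UNIV (\<lambda>\<tau>. A (conf_time_inv \<alpha> \<tau>))"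
    by (rule continuous_on_compose2[OF A continuous_conf_time(2)[OF \<alpha>]]) simp
  then show "continuous_on UNIV (\<lambda>\<tau>. A (conf_time_inv \<alpha> \<tau>) ** X (conf_time_inv \<alpha> \<tau>))"
    by (rule matmul.continuous_on[OF _ Xc])
  fix \<tau> :: real assume "\<tau> \<noteq> 0"
  then show "((\<lambda>\<tau>. X (conf_time_inv \<alpha> \<tau>)) has_vector_derivative
      A (conf_time_inv \<alpha> \<tau>) ** X (conf_time_inv \<alpha> \<tau>)) (at \<tau>)"
    using sol
    by (intro has_vector_derivative_columns conf_deriv_imp_has_vector_derivative[OF \<alpha>])
      (auto simp: conf_solution_def column_matrix_mult)
qed

lemma fundamental_matrix_of_rescaled:
  fixes A Y :: "real \<Rightarrow> real^'n^'n"
  assumes \<alpha>: "\<alpha> > 0" and A: "continuous_on UNIV A" and Y0: "Y 0 = mat 1"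
    and Y: "\<And>\<tau>. (Y has_vector_derivative A (conf_time_inv \<alpha> \<tau>) ** Y \<tau>) (at \<tau>)"
  shows "fundamental_matrix \<alpha> A (\<lambda>t. Y (conf_time \<alpha> t))"
  unfolding fundamental_matrix_def
proof (intro conjI allI impI)
  have Yc: "continuous_on UNIV Y"
    by (rule continuous_on_vector_derivative[OF has_vector_derivative_at_within[OF Y]])
  have Ac: "continuous_on UNIV (\<lambda>\<tau>. A (conf_time_inv \<alpha> \<tau>))"
    by (rule continuous_on_compose2[OF A continuous_conf_time(2)[OF \<alpha>]]) simp
  fix j
  let ?d = "\<lambda>\<tau>. column j (A (conf_time_inv \<alpha> \<tau>) ** Y \<tau>)"
  have "((\<lambda>\<tau>. column j (Y \<tau>)) has_vector_derivative ?d \<tau>) (at \<tau>)" for \<tau>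
    by (rule bounded_linear.has_vector_derivative[OF bounded_linear_column Y])
  moreover have "continuous_on UNIV ?d"
    by (intro bounded_linear.continuous_on[OF bounded_linear_column] matmul.continuous_on Ac Yc)
  ultimately have "has_conf_deriv \<alpha> (\<lambda>t. column j (Y (conf_time \<alpha> t))) (?d (conf_time \<alpha> t)) t" for t
    by (rule has_conf_deriv_compose[OF \<alpha>])
  moreover have "continuous_on UNIV (\<lambda>t. column j (Y (conf_time \<alpha> t)))"
    by (intro bounded_linear.continuous_on[OF bounded_linear_column]
        continuous_on_compose2[OF Yc continuous_conf_time(1)[OF \<alpha>]]) simp
  ultimately show "conf_solution \<alpha> A (\<lambda>t. column j (Y (conf_time \<alpha> t)))"
    by (simp add: conf_solution_def conf_time_inverse[OF \<alpha>] column_matrix_mult)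
next
  fix c :: "'n \<Rightarrow> real" and j
  assume "\<forall>t. (\<Sum>j\<in>UNIV. c j *\<^sub>R column j (Y (conf_time \<alpha> t))) = 0"
  \<comment> \<open>At \<open>t = 0\<close> the columns are the unit vectors, so a vanishing
    combination there already forces zero coefficients.\<close>
  from this[rule_format, of 0] have "(\<Sum>k\<in>UNIV. c k *\<^sub>R column k (mat 1 :: real^'n^'n)) = 0"
    by (simp add: conf_time_0[OF \<alpha>] Y0)
  then have "(\<Sum>k\<in>UNIV. c k *\<^sub>R column k (mat 1 :: real^'n^'n)) $ j = 0"
    by simp
  then show "c j = 0"
    by (simp add: column_def mat_def if_distrib cong: if_cong)
qed

theorem theorem4p1:
  fixes \<alpha> :: real and A X :: "real \<Rightarrow> real^'n^'n" and P :: "real^'n^'n"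
    and N1 N2 \<beta>1 \<beta>2 :: real
  assumes "0 < \<alpha>" and "\<alpha> \<le> 1"
    and "continuous_on UNIV A"
    and "fundamental_matrix \<alpha> A X" and "X 0 = mat 1"
    and "P ** P = P"
    and "N1 > 0" and "N2 > 0" and "\<beta>1 > 0" and "\<beta>2 > 0"
    and "mittag_leffler_estimates \<alpha> X P N1 N2 \<beta>1 \<beta>2"
  shows "\<exists>\<epsilon>0>0. \<forall>B :: real \<Rightarrow> real^'n^'n.
           continuous_on UNIV B \<longrightarrow> bounded (range B) \<longrightarrow>
           (SUP t\<in>{0..}. colsum_norm (B t)) < \<epsilon>0 \<longrightarrow>
           mittag_leffler_dichotomy \<alpha> (\<lambda>t. A t + B t)"
proof -

  \<comment> \<open>Transfer of the dichotomy to the new time\<close>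
  note \<alpha> = assms(1) and A = assms(3)
  define \<theta> where "\<theta> = conf_time \<alpha>"
  define \<sigma> where "\<sigma> = conf_time_inv \<alpha>"
  have \<theta>\<sigma>: "\<theta> (\<sigma> \<tau>) = \<tau>" and \<sigma>\<theta>: "\<sigma> (\<theta> t) = t" for \<tau> t
    by (simp_all add: \<theta>_def \<sigma>_def conf_time_inverse[OF \<alpha>])
  have \<theta>0: "\<theta> 0 = 0" and \<sigma>0: "\<sigma> 0 = 0"
    by (simp_all add: \<theta>_def \<sigma>_def conf_time_0[OF \<alpha>])
  have \<theta>_mono: "\<theta> s \<le> \<theta> t" and \<sigma>_mono: "\<sigma> s \<le> \<sigma> t" if "0 \<le> s" "s \<le> t" for s t
    using conf_time_mono[OF \<alpha> that] conf_time_inv_mono[OF \<alpha> that] by (simp_all add: \<theta>_def \<sigma>_def)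
  have \<theta>_nonneg: "0 \<le> \<theta> t" and \<sigma>_nonneg: "0 \<le> \<sigma> t" if "0 \<le> t" for t
    using \<theta>_mono[of 0 t] \<sigma>_mono[of 0 t] that by (simp_all add: \<theta>0 \<sigma>0)
  have \<sigma>c: "continuous_on UNIV \<sigma>"
    unfolding \<sigma>_def by (rule continuous_conf_time(2)[OF \<alpha>])
  have E_ratio: "E_conf \<alpha> l s / E_conf \<alpha> l t = exp (- l * (\<theta> t - \<theta> s))"
    if "0 \<le> s" "0 \<le> t" for l s t
    using that by (simp add: E_conf_eq \<theta>_def exp_diff[symmetric] right_diff_distrib)
  define n where "n = real CARD('n)"
  have n: "n > 0" by (simp add: n_def)
  define a where "a \<tau> = A (\<sigma> \<tau>)" for \<tau>
  define x where "x \<tau> = X (\<sigma> \<tau>)" for \<tau>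
  have ac: "continuous_on UNIV a"
    unfolding a_def by (rule continuous_on_compose2[OF A \<sigma>c]) simp
  have x': "(x has_vector_derivative a \<tau> ** x \<tau>) (at \<tau>)" for \<tau>
    unfolding x_def a_def \<sigma>_def by (rule fundamental_matrix_rescaled[OF \<alpha> A assms(4)])
  have x0: "x 0 = mat 1"
    by (simp add: x_def \<sigma>0 assms(5))
  obtain z where z': "\<And>\<tau>. (z has_vector_derivative - (z \<tau> ** a \<tau>)) (at \<tau>)"
    and zx: "\<And>\<tau>. z \<tau> ** x \<tau> = mat 1" and xz: "\<And>\<tau>. x \<tau> ** z \<tau> = mat 1"
    using linear_ode_inverse[OF ac x0 x'] by blast
  have inv_x: "matrix_inv (X (\<sigma> s)) = z s" for s
    using matrix_inv_eqI[OF zx] by (simp add: x_def)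
  \<comment> \<open>One rate and one constant serve both estimates; the factor \<open>n\<close> in
    \<open>N\<close> pays for passing from \<open>colsum_norm\<close> to
    \<open>norm\<close>.\<close>
  define \<beta> where "\<beta> = min \<beta>1 \<beta>2"
  define N where "N = n * max N1 N2"
  have \<beta>: "\<beta> > 0" "\<beta> \<le> \<beta>1" "\<beta> \<le> \<beta>2" and N: "N > 0"
    using assms n by (auto simp: \<beta>_def N_def)
  have weaken: "norm M \<le> N * exp (- \<beta> * d)"
    if "colsum_norm M \<le> N' * exp (- \<beta>' * d)" "N' \<le> max N1 N2" "\<beta> \<le> \<beta>'" "0 \<le> d"
    for M :: "real^'n^'n" and N' \<beta>' d
  proof -
    have "norm M \<le> n * colsum_norm M"
      unfolding n_def by (rule norm_le_colsum_norm)
    also have "\<dots> \<le> n * (max N1 N2 * exp (- \<beta> * d))"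
    proof (intro mult_left_mono)
      have "N' * exp (- \<beta>' * d) \<le> max N1 N2 * exp (- \<beta> * d)"
        using that assms by (intro mult_mono) (auto intro: mult_right_mono)
      then show "colsum_norm M \<le> max N1 N2 * exp (- \<beta> * d)"
        using that(1) by linarith
    qed (use n in simp)
    finally show ?thesis by (simp add: N_def mult.assoc)
  qed
  note est = assms(11)[unfolded mittag_leffler_estimates_def]
  interpret exponential_dichotomy a x z P N \<beta>
  proof
    show "norm (x t ** P ** z s) \<le> N * exp (- \<beta> * (t - s))" if "0 \<le> s" "s \<le> t" for s t
    proof (rule weaken)
      show "colsum_norm (x t ** P ** z s) \<le> N1 * exp (- \<beta>1 * (t - s))"
        using est[THEN conjunct1, rule_format, of "\<sigma> s" "\<sigma> t"] that
        by (simp add: E_ratio \<sigma>_nonneg \<sigma>_mono \<theta>\<sigma> inv_x x_def)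
    qed (use \<beta> that in auto)
    show "norm (x t ** (mat 1 - P) ** z s) \<le> N * exp (- \<beta> * (s - t))" if "0 \<le> t" "t \<le> s" for s t
    proof (rule weaken)
      show "colsum_norm (x t ** (mat 1 - P) ** z s) \<le> N2 * exp (- \<beta>2 * (s - t))"
        using est[THEN conjunct2, rule_format, of "\<sigma> t" "\<sigma> s"] that
        by (simp add: E_ratio \<sigma>_nonneg \<sigma>_mono \<theta>\<sigma> inv_x x_def)
    qed (use \<beta> that in auto)
  qed (use x' z' zx xz x0 assms(6) \<beta> in auto)
  \<comment> \<open>This gives equality in \<open>small\<close>. The threshold is
    \<open>\<epsilon> / n\<close>, since turning a bound on \<open>colsum_norm\<close> into one on
    \<open>norm\<close> costs the factor \<open>n\<close>.\<close>
  define \<epsilon> where "\<epsilon> = \<beta> / (8 * N)"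
  show ?thesis
  proof (intro exI[of _ "\<epsilon> / n"] conjI allI impI)
    show "0 < \<epsilon> / n"
      using \<beta> N n by (simp add: \<epsilon>_def)
    fix B :: "real \<Rightarrow> real^'n^'n"
    assume B: "continuous_on UNIV B" "bounded (range B)"
      and sup: "(SUP t\<in>{0..}. colsum_norm (B t)) < \<epsilon> / n"
    \<comment> \<open>A real \<open>SUP\<close> is known to dominate its members only for a set
      bounded above; boundedness of \<open>B\<close> provides this.\<close>
    have "bdd_above ((\<lambda>t. colsum_norm (B t)) ` {0..})"
    proof -
      obtain K where K: "\<And>t. norm (B t) \<le> K"
        using B(2) by (auto simp: bounded_iff)
      have "colsum_norm (B t) \<le> n * K" for t
        unfolding n_def by (rule order_trans[OF colsum_norm_le_norm mult_left_mono[OF K]]) simp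
      then show ?thesis by (rule bdd_aboveI2)
    qed
    then have lt: "colsum_norm (B t) < \<epsilon> / n" if "0 \<le> t" for t
      using cSUP_upper[of t "{0..}" "\<lambda>t. colsum_norm (B t)"] sup that by simp
    have B_le: "norm (B t) \<le> \<epsilon>" if "0 \<le> t" for t
    proof -
      have "norm (B t) \<le> n * colsum_norm (B t)"
        unfolding n_def by (rule norm_le_colsum_norm)
      also have "\<dots> \<le> n * (\<epsilon> / n)"
        by (intro mult_left_mono less_imp_le lt that n)
      finally show ?thesis using n by simp
    qed

    \<comment> \<open>The perturbed equation in the new time\<close>
    define b where "b \<tau> = B (\<sigma> \<tau>)" for \<tau>
    have bc: "continuous_on UNIV b"
      unfolding b_def by (rule continuous_on_compose2[OF B(1) \<sigma>c]) simp
    have cc: "continuous_on UNIV (\<lambda>\<tau>. a \<tau> + b \<tau>)"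
      by (intro continuous_intros ac bc)
    obtain Y where Y0: "Y 0 = mat 1" and Y': "\<And>\<tau>. (Y has_vector_derivative (a \<tau> + b \<tau>) ** Y \<tau>) (at \<tau>)"
      using linear_ode_exists[OF cc] by blast
    obtain V where V': "\<And>\<tau>. (V has_vector_derivative - (V \<tau> ** (a \<tau> + b \<tau>))) (at \<tau>)"
      and VY: "\<And>\<tau>. V \<tau> ** Y \<tau> = mat 1" and YV: "\<And>\<tau>. Y \<tau> ** V \<tau> = mat 1"
      using linear_ode_inverse[OF cc Y0 Y'] by blast
    interpret perturbed_dichotomy a x z P N \<beta> b Y V \<epsilon>
    proof
      show "norm (b t) \<le> \<epsilon>" if "0 \<le> t" for t
        unfolding b_def by (rule B_le[OF \<sigma>_nonneg[OF that]])
      show "8 * N * \<epsilon> \<le> \<beta>"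
        using N by (simp add: \<epsilon>_def)
    qed (fact bc Y' V' VY YV Y0)+
    obtain Q where Q: "Q ** Q = Q"
      and s: "\<And>s t. 0 \<le> s \<Longrightarrow> s \<le> t \<Longrightarrow> norm (Y t ** Q ** V s) \<le> 2 * N * exp (- (\<beta> / 2) * (t - s))"
      and u: "\<And>s t. 0 \<le> t \<Longrightarrow> t \<le> s \<Longrightarrow> norm (Y t ** (mat 1 - Q) ** V s)
        \<le> (norm (mat 1 :: real^'n^'n) + 2 * N) * exp (- (\<beta> / 2) * (s - t))"
      using roughness by blast

    \<comment> \<open>Return to the original time\<close>
    have inv_Y: "matrix_inv (Y \<tau>) = V \<tau>" for \<tau>
      by (rule matrix_inv_eqI[OF VY])
    have fund: "fundamental_matrix \<alpha> (\<lambda>t. A t + B t) (\<lambda>t. Y (\<theta> t))"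
      unfolding \<theta>_def
      by (rule fundamental_matrix_of_rescaled[OF \<alpha>])
        (use A B(1) Y0 Y' in \<open>auto intro!: continuous_intros simp: a_def b_def \<sigma>_def\<close>)
    define C1 where "C1 = n * (2 * N)"
    define C2 where "C2 = n * (norm (mat 1 :: real^'n^'n) + 2 * N)"
    have colsum: "colsum_norm M \<le> n * K * e" if "norm M \<le> K * e" for M :: "real^'n^'n" and K e
      unfolding n_def mult.assoc
      by (rule order_trans[OF colsum_norm_le_norm mult_left_mono[OF that]]) simp
    have "mittag_leffler_estimates \<alpha> (\<lambda>t. Y (\<theta> t)) Q C1 C2 (\<beta> / 2) (\<beta> / 2)"
      unfolding mittag_leffler_estimates_def
    proof (intro conjI allI impI; elim conjE)
      fix s' t' :: real assume st: "0 \<le> s'" "s' \<le> t'"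
      have "colsum_norm (Y (\<theta> t') ** Q ** V (\<theta> s')) \<le> C1 * exp (- (\<beta> / 2) * (\<theta> t' - \<theta> s'))"
        unfolding C1_def by (intro colsum s \<theta>_nonneg \<theta>_mono st)
      then show "colsum_norm (Y (\<theta> t') ** Q ** matrix_inv (Y (\<theta> s')))
          \<le> C1 * (E_conf \<alpha> (\<beta> / 2) s' / E_conf \<alpha> (\<beta> / 2) t')"
        using st by (simp add: E_ratio inv_Y)
    next
      fix s' t' :: real assume st: "0 \<le> t'" "t' \<le> s'"
      have "colsum_norm (Y (\<theta> t') ** (mat 1 - Q) ** V (\<theta> s')) \<le> C2 * exp (- (\<beta> / 2) * (\<theta> s' - \<theta> t'))"
        unfolding C2_def by (intro colsum u \<theta>_nonneg \<theta>_mono st)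
      then show "colsum_norm (Y (\<theta> t') ** (mat 1 - Q) ** matrix_inv (Y (\<theta> s')))
          \<le> C2 * (E_conf \<alpha> (\<beta> / 2) t' / E_conf \<alpha> (\<beta> / 2) s')"
        using st by (simp add: E_ratio inv_Y)
    qed
    moreover have "C1 > 0" "C2 > 0"
      using n N by (auto simp: C1_def C2_def intro!: mult_pos_pos add_nonneg_pos)
    ultimately show "mittag_leffler_dichotomy \<alpha> (\<lambda>t. A t + B t)"
      unfolding mittag_leffler_dichotomy_def using fund Q \<beta>(1)
      by (intro exI[of _ "\<lambda>t. Y (\<theta> t)"] exI[of _ Q] exI[of _ C1] exI[of _ C2] exI[of _ "\<beta> / 2"]) simp
  qed
qed

end
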